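(* Let $n,h\in\mathbb N$ with $n\ge h$, and let $\mathcal G$ be the step-two group on $\mathbb R^{2n}\times\mathbb R^h$ described in the context, with indices $i_1,\dots,i_h$ and invertible matrix $A$ as there. Let $d\in C^\infty(\mathcal G\setminus\{0\})$ be a homogeneous norm, $p\ge2$, $\theta\in\mathbb R$, and set \[ Z_d=\frac{z}{d}+\sum_{k=1}^h\frac{\mathbf z^{(i_k)}}{d}-2p\theta\sum_{j,k=1}^h(A^{-1})_{jk}\,\frac{t_j}{d^2}\,\nabla^\perp_{2i_k-1,2i_k}d . \] Then for every $u\in C_c^\infty(\mathcal G\setminus\{0\})$, \[ \int_{\mathcal G}\frac{|\langle\nabla_{\mathcal G}u,Z_d\rangle|^p}{d^{p(\theta-1)}}\,dz\,dt\ge\left|\frac{Q-p\theta}{p}\right|^p\int_{\mathcal G}\frac{|u|^p}{d^{p\theta}}\,dz\,dt . \]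
   Context: Let $B^{(1)},\dots,B^{(h)}\in\mathbb R^{2n\times2n}$ be linearly independent, pairwise commuting skew-symmetric matrices, in the block form $B^{(j)}=\mathrm{diag}\left(\begin{pmatrix}0&\lambda^{(j)}_1\\-\lambda^{(j)}_1&0\end{pmatrix},\dots,\begin{pmatrix}0&\lambda^{(j)}_n\\-\lambda^{(j)}_n&0\end{pmatrix}\right)$ with $\lambda^{(j)}_i\ge0$. $\mathcal G$ is $\mathbb R^{2n}\times\mathbb R^h$ with coordinates $(z,t)$, group law $(z,t)\circ(\eta,\tau)=(z+\eta,t+\tau+\tfrac12(\langle B^{(1)}z,\eta\rangle,\dots,\langle B^{(h)}z,\eta\rangle))$, dilations $\delta_\gamma(z,t)=(\gamma z,\gamma^2t)$, homogeneous dimension $Q=2n+2h$. Horizontal fields $X_{2i-1}=\partial_{z_{2i-1}}+\sum_j\frac{\lambda^{(j)}_i}{2}z_{2i}\partial_{t_j}$, $X_{2i}=\partial_{z_{2i}}-\sum_j\frac{\lambda^{(j)}_i}{2}z_{2i-1}\partial_{t_j}$, $\nabla_{\mathcal G}u=(X_1u,\dots,X_{2n}u)$; horizontal vector fields are identified with $\mathbb R^{2n}$-valued functions via this basis. Indices $i_1,\dots,i_h\in\{1,\dots,n\}$ are chosen so that the $h\times h$ matrix $A$ with entries $A_{kj}=\lambda^{(j)}_{i_k}$ is invertible. $\mathbf z^{(i)}=(0,\dots,0,z_{2i-1},z_{2i},0,\dots,0)$ and $\nabla^\perp_{2i-1,2i}u=(0,\dots,0,-X_{2i}u,X_{2i-1}u,0,\dots,0)$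 (nonzero entries in positions $2i-1,2i$). A homogeneous norm is a continuous $d\ge0$ with $d(\delta_\lambda(z,t))=\lambda d(z,t)$, $d>0$ off the origin, and $d((z,t)\circ(\eta,\tau))\le d(z,t)+d(\eta,\tau)$. *)

theory Defs
  imports "HOL-Analysis.Analysis"
begin

text \<open>Points of G = R^{2n} x R^h are ((x, y), t) with x, y :: real^'n, t :: real^'h,
  where z_{2i-1} = x$i, z_{2i} = y$i.  The parameters lambda^{(j)}_i are lam j i.\<close>

type_synonym ('n, 'h) pt = "((real^'n) \<times> (real^'n)) \<times> (real^'h)"

text \<open>Group law: (z,t) o (eta,tau) = (z+eta, t+tau+1/2 (<B^{(j)} z, eta>)_j).\<close>
definition grp_mult :: "('h \<Rightarrow> 'n \<Rightarrow> real) \<Rightarrow> ('n::finite,'h::finite) pt \<Rightarrow> ('n,'h) pt \<Rightarrow> ('n,'h) pt" where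
  "grp_mult lam P R =
     (case P of ((x, y), t) \<Rightarrow> case R of ((\<xi>, \<upsilon>), \<tau>) \<Rightarrow>
       ((x + \<xi>, y + \<upsilon>),
        t + \<tau> + (\<chi> j. (1/2) * (\<Sum>i\<in>UNIV. lam j i * (y$i * \<xi>$i - x$i * \<upsilon>$i)))))"

definition dil :: "real \<Rightarrow> ('n::finite,'h::finite) pt \<Rightarrow> ('n,'h) pt" where
  "dil \<gamma> P = (case P of ((x, y), t) \<Rightarrow> ((\<gamma> *\<^sub>R x, \<gamma> *\<^sub>R y), \<gamma>\<^sup>2 *\<^sub>R t))"

definition homogeneous_norm :: "('h \<Rightarrow> 'n \<Rightarrow> real) \<Rightarrow> (('n::finite,'h::finite) pt \<Rightarrow> real) \<Rightarrow> bool" where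
  "homogeneous_norm lam d \<longleftrightarrow>
     continuous_on UNIV d \<and> (\<forall>P. d P \<ge> 0) \<and>
     (\<forall>\<gamma> P. \<gamma> > 0 \<longrightarrow> d (dil \<gamma> P) = \<gamma> * d P) \<and>
     (\<forall>P. P \<noteq> 0 \<longrightarrow> d P > 0) \<and>
     (\<forall>P R. d (grp_mult lam P R) \<le> d P + d R)"

fun iter_dd :: "'a::real_normed_vector list \<Rightarrow> ('a \<Rightarrow> real) \<Rightarrow> ('a \<Rightarrow> real)" where
  "iter_dd [] f = f"
| "iter_dd (v # vs) f = (\<lambda>p. frechet_derivative (iter_dd vs f) (at p) v)"

definition smooth_on :: "'a::real_normed_vector set \<Rightarrow> ('a \<Rightarrow> real) \<Rightarrow> bool" where
  "smooth_on S f \<longleftrightarrow> (\<forall>vs. iter_dd vs f differentiable_on S \<and> continuous_on S (iter_dd vs f))"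

definition Cc_inf_punctured :: "(('n::finite,'h::finite) pt \<Rightarrow> real) \<Rightarrow> bool" where
  "Cc_inf_punctured u \<longleftrightarrow> smooth_on (- {0}) u \<and>
     compact (closure {p. u p \<noteq> 0}) \<and> closure {p. u p \<noteq> 0} \<subseteq> - {0}"

definition ddir :: "(('n::finite,'h::finite) pt \<Rightarrow> real) \<Rightarrow> ('n,'h) pt \<Rightarrow> ('n,'h) pt \<Rightarrow> real" where
  "ddir u p v = frechet_derivative u (at p) v"

definition Xodd :: "('h::finite \<Rightarrow> 'n::finite \<Rightarrow> real) \<Rightarrow> 'n \<Rightarrow> (('n,'h) pt \<Rightarrow> real) \<Rightarrow> ('n,'h) pt \<Rightarrow> real" where
  "Xodd lam i u p = ddir u p ((axis i 1, 0), 0)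
     + (\<Sum>j\<in>UNIV. lam j i / 2 * (snd (fst p)) $ i * ddir u p ((0, 0), axis j 1))"

definition Xeven :: "('h::finite \<Rightarrow> 'n::finite \<Rightarrow> real) \<Rightarrow> 'n \<Rightarrow> (('n,'h) pt \<Rightarrow> real) \<Rightarrow> ('n,'h) pt \<Rightarrow> real" where
  "Xeven lam i u p = ddir u p ((0, axis i 1), 0)
     - (\<Sum>j\<in>UNIV. lam j i / 2 * (fst (fst p)) $ i * ddir u p ((0, 0), axis j 1))"

text \<open>The vector field Z_d, as (odd components, even components) in R^{2n}.
  ix k = i_k; A k j = lam j (ix k).
  Z_d = z/d + sum_k z^{(i_k)}/d - 2 p theta sum_{j,k} (A^{-1})_{jk} t_j/d^2 nablaperp_{2i_k-1,2i_k} d,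
  where nablaperp_{2i-1,2i} d = (..., -X_{2i} d, X_{2i-1} d, ...).\<close>
definition Amat :: "('h::finite \<Rightarrow> 'n::finite \<Rightarrow> real) \<Rightarrow> ('h \<Rightarrow> 'n) \<Rightarrow> real^'h^'h" where
  "Amat lam ix = (\<chi> k j. lam j (ix k))"

definition Zodd :: "('h::finite \<Rightarrow> 'n::finite \<Rightarrow> real) \<Rightarrow> ('h \<Rightarrow> 'n) \<Rightarrow> real \<Rightarrow> real \<Rightarrow>
    (('n,'h) pt \<Rightarrow> real) \<Rightarrow> ('n,'h) pt \<Rightarrow> 'n \<Rightarrow> real" where
  "Zodd lam ix p \<theta> d P i =
     (fst (fst P)) $ i / d P
     + (\<Sum>k\<in>UNIV. if ix k = i then (fst (fst P)) $ i / d P else 0)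
     - 2 * p * \<theta> * (\<Sum>j\<in>UNIV. \<Sum>k\<in>UNIV.
          matrix_inv (Amat lam ix) $ j $ k * (snd P) $ j / (d P)\<^sup>2 *
          (if ix k = i then - Xeven lam i d P else 0))"

definition Zeven :: "('h::finite \<Rightarrow> 'n::finite \<Rightarrow> real) \<Rightarrow> ('h \<Rightarrow> 'n) \<Rightarrow> real \<Rightarrow> real \<Rightarrow>
    (('n,'h) pt \<Rightarrow> real) \<Rightarrow> ('n,'h) pt \<Rightarrow> 'n \<Rightarrow> real" where
  "Zeven lam ix p \<theta> d P i =
     (snd (fst P)) $ i / d P
     + (\<Sum>k\<in>UNIV. if ix k = i then (snd (fst P)) $ i / d P else 0)
     - 2 * p * \<theta> * (\<Sum>j\<in>UNIV. \<Sum>k\<in>UNIV.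
          matrix_inv (Amat lam ix) $ j $ k * (snd P) $ j / (d P)\<^sup>2 *
          (if ix k = i then Xodd lam i d P else 0))"

definition gradZ :: "('h::finite \<Rightarrow> 'n::finite \<Rightarrow> real) \<Rightarrow> ('h \<Rightarrow> 'n) \<Rightarrow> real \<Rightarrow> real \<Rightarrow>
    (('n,'h) pt \<Rightarrow> real) \<Rightarrow> (('n,'h) pt \<Rightarrow> real) \<Rightarrow> ('n,'h) pt \<Rightarrow> real" where
  "gradZ lam ix p \<theta> d u P =
     (\<Sum>i\<in>UNIV. Xodd lam i u P * Zodd lam ix p \<theta> d P i + Xeven lam i u P * Zeven lam ix p \<theta> d P i)"

end

theory Submission
  imports Defs
begin

text \<open>
  Put \<open>f = d powr (- p \<theta>)\<close>. The horizontal field \<open>d powr (1 - p \<theta>) Z_d\<close> equals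
  \<open>f (z + \<Sum>_k z^(i_k)) + 2 \<Sum>_jk (A^-1)_jk t_j N_k f\<close>, where \<open>N_k\<close> is the rotated horizontal gradient
  in the plane of index \<open>i_k\<close>. The divergence of \<open>N_k f\<close> is a commutator of horizontal derivatives,
  namely \<open>\<Sum>_l A_kl \<partial>f/\<partial>t_l\<close>, so the inverse matrix turns it into the missing vertical part of the
  Euler field, while the derivatives of the \<open>t_j\<close> cancel the extra derivatives of \<open>f\<close> along \<open>z^(i_k)\<close>.
  As \<open>f\<close> is homogeneous of degree \<open>- p \<theta>\<close>, the total divergence is \<open>(Q - p \<theta>) f\<close>. Testing it
  against \<open>\<bar>u\<bar> powr p\<close> and applying Young's inequality pointwise, with the weight
  \<open>c = \<bar>(Q - p \<theta>) / p\<bar>\<close> on the side of \<open>u\<close>, gives the inequality without Hoelder's inequality.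
\<close>

section \<open>Second derivatives and integration by parts\<close>

lemma has_real_derivative_along_line:
  fixes f :: "'a::real_normed_vector \<Rightarrow> real"
  assumes "(f has_derivative f') (at (q + a *\<^sub>R v))"
  shows "((\<lambda>a. f (q + a *\<^sub>R v)) has_real_derivative f' v) (at a)"
proof -
  have "((\<lambda>a. q + a *\<^sub>R v) has_derivative (\<lambda>h. h *\<^sub>R v)) (at a)"
    by (auto intro!: derivative_eq_intros)
  then have "((\<lambda>a. f (q + a *\<^sub>R v)) has_derivative (\<lambda>h. f' (h *\<^sub>R v))) (at a)"
    by (rule has_derivative_compose) (use assms in simp)
  moreover have "f' (h *\<^sub>R v) = f' v * h" for h
    using linear_scale[OF has_derivative_linear[OF assms]] by simp
  ultimately show ?thesis
    by (simp add: has_field_derivative_def)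
qed

text \<open>The mean value theorem is applied twice: in direction \<open>v\<close> to the difference
  of \<open>f\<close> along two parallel segments, then in direction \<open>w\<close> to
  \<open>f' _ v\<close>. The second difference is symmetric in \<open>v\<close> and
  \<open>w\<close>, so exchanging them relates the two mixed derivatives.\<close>

lemma second_difference_mvt:
  fixes f :: "'a::real_normed_vector \<Rightarrow> real"
  assumes f: "\<And>y. y \<in> S \<Longrightarrow> (f has_derivative f' y) (at y)"
    and H: "\<And>y. y \<in> S \<Longrightarrow> ((\<lambda>z. f' z v) has_derivative H y) (at y)"
    and S: "\<And>a b. \<lbrakk>0 \<le> a; a \<le> s; 0 \<le> b; b \<le> s\<rbrakk> \<Longrightarrow> x + a *\<^sub>R v + b *\<^sub>R w \<in> S"
    and s: "0 < s"
  obtains a b where "0 \<le> a" "a \<le> s" "0 \<le> b" "b \<le> s"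
    "f (x + s *\<^sub>R v + s *\<^sub>R w) - f (x + s *\<^sub>R w) - f (x + s *\<^sub>R v) + f x
       = s\<^sup>2 * H (x + a *\<^sub>R v + b *\<^sub>R w) w"
proof -
  have eq: "x + b *\<^sub>R w + a *\<^sub>R v = x + a *\<^sub>R v + b *\<^sub>R w" for a b
    by simp
  have "((\<lambda>a. f ((x + s *\<^sub>R w) + a *\<^sub>R v) - f (x + a *\<^sub>R v)) has_real_derivative
      f' (x + s *\<^sub>R w + a *\<^sub>R v) v - f' (x + a *\<^sub>R v) v) (at a)" if "0 \<le> a" "a \<le> s" for a
    using S[of a s] S[of a 0] that s
    by (intro DERIV_diff has_real_derivative_along_line f) (auto simp: eq)
  from MVT2[OF s this] obtain a where a: "0 < a" "a < s"
    "(f (x + s *\<^sub>R w + s *\<^sub>R v) - f (x + s *\<^sub>R v)) - (f (x + s *\<^sub>R w) - f x)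
      = s * (f' (x + s *\<^sub>R w + a *\<^sub>R v) v - f' (x + a *\<^sub>R v) v)"
    by auto
  have "((\<lambda>b. f' ((x + a *\<^sub>R v) + b *\<^sub>R w) v) has_real_derivative H (x + a *\<^sub>R v + b *\<^sub>R w) w) (at b)"
    if "0 \<le> b" "b \<le> s" for b
    using S[of a b] that a by (intro has_real_derivative_along_line H) auto
  from MVT2[OF s this] obtain b where b: "0 < b" "b < s"
    "f' (x + a *\<^sub>R v + s *\<^sub>R w) v - f' (x + a *\<^sub>R v) v = s * H (x + a *\<^sub>R v + b *\<^sub>R w) w"
    by auto
  show ?thesis
    using a b by (intro that[of a b]) (auto simp: eq power2_eq_square)
qed

text \<open>Schwarz's theorem: the second difference, taken in both orders, makes the two mixed
  derivatives agree at two nearby points, and continuity carries this to \<open>x\<close>.\<close>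

lemma second_derivative_symmetric:
  fixes f :: "'a::real_normed_vector \<Rightarrow> real"
  assumes S: "open S" "x \<in> S"
    and f: "\<And>y. y \<in> S \<Longrightarrow> (f has_derivative f' y) (at y)"
    and H: "\<And>y b. y \<in> S \<Longrightarrow> ((\<lambda>z. f' z b) has_derivative H b y) (at y)"
    and cont: "\<And>b c. continuous_on S (\<lambda>y. H b y c)"
  shows "H v x w = H w x v"
proof (rule ccontr)
  assume neq: "H v x w \<noteq> H w x v"
  \<comment> \<open>Half the gap: two errors below \<open>e\<close> cannot bridge it.\<close>
  define e where "e = \<bar>H v x w - H w x v\<bar> / 2"
  have e: "0 < e" using neq by (simp add: e_def)
  have ev: "\<forall>\<^sub>F y in nhds x. dist (H b y c) (H b x c) < e" for b c
  proof -
    have "isCont (\<lambda>y. H b y c) x"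
      using cont S continuous_on_eq_continuous_at by blast
    then show ?thesis
      using e by (auto simp: continuous_at_eps_delta eventually_nhds_metric)
  qed
  have "\<forall>\<^sub>F y in nhds x. y \<in> S \<and> dist (H v y w) (H v x w) < e \<and> dist (H w y v) (H w x v) < e"
    using ev[of v w] ev[of w v] eventually_nhds_in_open[OF S] by (intro eventually_conj)
  then obtain \<delta> where \<delta>: "0 < \<delta>"
    "\<And>y. dist y x < \<delta> \<Longrightarrow> y \<in> S \<and> dist (H v y w) (H v x w) < e \<and> dist (H w y v) (H w x v) < e"
    by (auto simp: eventually_nhds_metric)
  \<comment> \<open>The parallelogram with sides \<open>s v\<close> and \<open>s w\<close> at
    \<open>x\<close> then stays in the ball of radius \<delta>; the summand 1 keeps the denominator
    positive when \<open>v\<close> and \<open>w\<close> vanish.\<close>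
  define s where "s = \<delta> / 2 / (norm v + norm w + 1)"
  have s: "0 < s"
    unfolding s_def using \<delta> by (intro divide_pos_pos) (auto intro: add_nonneg_pos)
  have near: "dist (x + a *\<^sub>R v + b *\<^sub>R w) x < \<delta>" if "0 \<le> a" "a \<le> s" "0 \<le> b" "b \<le> s" for a b
  proof -
    have "dist (x + a *\<^sub>R v + b *\<^sub>R w) x = norm (a *\<^sub>R v + b *\<^sub>R w)"
      by (simp add: dist_norm)
    also have "\<dots> \<le> norm (a *\<^sub>R v) + norm (b *\<^sub>R w)"
      by (rule norm_triangle_ineq)
    also have "\<dots> = a * norm v + b * norm w"
      using that by simp
    also have "\<dots> \<le> s * norm v + s * norm w"
      using that by (intro add_mono mult_right_mono) auto
    also have "\<dots> \<le> s * (norm v + norm w + 1)"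
      using s by (simp add: algebra_simps)
    also have "\<dots> = \<delta> / 2"
      using add_nonneg_pos[of "norm v + norm w" 1] nonzero_eq_divide_eq[of "norm v + norm w + 1" s "\<delta> / 2"]
      by (simp add: s_def)
    finally show ?thesis using \<delta>(1) by simp
  qed
  obtain a b where ab: "0 \<le> a" "a \<le> s" "0 \<le> b" "b \<le> s"
    "f (x + s *\<^sub>R v + s *\<^sub>R w) - f (x + s *\<^sub>R w) - f (x + s *\<^sub>R v) + f x
       = s\<^sup>2 * H v (x + a *\<^sub>R v + b *\<^sub>R w) w"
    by (rule second_difference_mvt[of S f f' v "H v" s x w]) (use f H near \<delta> s in auto)
  have near': "dist (x + a *\<^sub>R w + b *\<^sub>R v) x < \<delta>" if "0 \<le> a" "a \<le> s" "0 \<le> b" "b \<le> s" for a b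
    using near[of b a] that by (simp add: add.assoc add.commute[of "a *\<^sub>R w"])
  obtain a' b' where ab': "0 \<le> a'" "a' \<le> s" "0 \<le> b'" "b' \<le> s"
    "f (x + s *\<^sub>R w + s *\<^sub>R v) - f (x + s *\<^sub>R v) - f (x + s *\<^sub>R w) + f x
       = s\<^sup>2 * H w (x + a' *\<^sub>R w + b' *\<^sub>R v) v"
    by (rule second_difference_mvt[of S f f' w "H w" s x v]) (use f H near' \<delta> s in auto)
  have swap: "x + s *\<^sub>R w + s *\<^sub>R v = x + s *\<^sub>R v + s *\<^sub>R w"
    by simp
  have "s\<^sup>2 * H v (x + a *\<^sub>R v + b *\<^sub>R w) w = s\<^sup>2 * H w (x + a' *\<^sub>R w + b' *\<^sub>R v) v"
    using ab(5) ab'(5)[unfolded swap] by linarith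
  then have "H v (x + a *\<^sub>R v + b *\<^sub>R w) w = H w (x + a' *\<^sub>R w + b' *\<^sub>R v) v"
    using s by simp
  then show False
    using \<delta>(2)[OF near[OF ab(1-4)]] \<delta>(2)[OF near'[OF ab'(1-4)]] e
    by (auto simp: e_def dist_real_def abs_if split: if_splits)
qed

section \<open>Integration by parts against affine fields\<close>

lemma has_derivative_zero_off_closed:
  fixes F :: "'a::real_normed_vector \<Rightarrow> real"
  assumes "closed K" "\<And>y. y \<notin> K \<Longrightarrow> F y = 0" "x \<notin> K" "(F has_derivative F') (at x)"
  shows "F' v = 0"
proof -
  have "((\<lambda>_. 0) has_derivative F') (at x)"
    by (rule has_derivative_transform_within_open[OF assms(4), of "- K"]) (use assms in auto)
  then have "F' = (\<lambda>_. 0)"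
    using has_derivative_unique has_derivative_const by blast
  then show ?thesis by simp
qed

text \<open>The difference quotients have integral zero by translation invariance, so no Fubini is needed.\<close>

lemma integral_directional_derivative_0:
  fixes F :: "'a::euclidean_space \<Rightarrow> real"
  assumes K: "compact K" and F0: "\<And>x. x \<notin> K \<Longrightarrow> F x = 0"
    and F: "\<And>x. (F has_derivative F' x) (at x)"
    and cont: "continuous_on UNIV (\<lambda>x. F' x v)"
  shows "has_bochner_integral lborel (\<lambda>x. F' x v) 0"
proof -
  have contF: "continuous_on UNIV F"
    by (intro continuous_at_imp_continuous_on ballI has_derivative_continuous[OF F])
  have F'0: "F' x v = 0" if "x \<notin> K" for x
    using has_derivative_zero_off_closed[OF compact_imp_closed[OF K] F0 that F] by blast
  have "bounded ((\<lambda>x. F' x v) ` K)"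
    by (intro compact_imp_bounded compact_continuous_image K continuous_on_subset[OF cont]) auto
  then obtain B where B: "0 < B" "\<And>x. x \<in> K \<Longrightarrow> \<bar>F' x v\<bar> \<le> B"
    by (auto simp: bounded_pos)
  then have B': "\<bar>F' x v\<bar> \<le> B" for x
    using F'0[of x] by (cases "x \<in> K") auto
  obtain R where R: "\<And>x. x \<in> K \<Longrightarrow> norm x \<le> R"
    using compact_imp_bounded[OF K] by (auto simp: bounded_iff)
  define s where "s n = inverse (real (Suc n))" for n
  have s: "0 < s n" "s n \<le> 1" for n
    by (auto simp: s_def inverse_eq_divide)
  define D where "D n x = (F (x + s n *\<^sub>R v) - F x) / s n" for n x
  have intF: "integrable lborel F"
  proof -
    have "integrable lborel (\<lambda>x. indicator K x *\<^sub>R F x)"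
      using borel_integrable_compact[OF K continuous_on_subset[OF contF]] by auto
    moreover have "(\<lambda>x. indicator K x *\<^sub>R F x) = F"
      using F0 by (auto simp: indicator_def fun_eq_iff)
    ultimately show ?thesis by simp
  qed
  have measF[measurable]: "F \<in> borel_measurable borel"
    using contF by (rule borel_measurable_continuous_onI)
  have meas'[measurable]: "(\<lambda>x. F' x v) \<in> borel_measurable borel"
    using cont by (rule borel_measurable_continuous_onI)
  have shift: "has_bochner_integral lborel (\<lambda>x. F (x + c)) (integral\<^sup>L lborel F)" for c
  proof -
    have "has_bochner_integral (distr lborel borel ((+) c)) F (integral\<^sup>L lborel F)"
      using intF by (simp add: lborel_distr_plus has_bochner_integral_iff)
    then have "has_bochner_integral lborel (\<lambda>x. F (c + x)) (integral\<^sup>L lborel F)"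
      by (auto simp: has_bochner_integral_iff integrable_distr_eq integral_distr)
    then show ?thesis by (simp add: add.commute)
  qed
  have intD: "integral\<^sup>L lborel (D n) = 0" for n
  proof -
    have "has_bochner_integral lborel (D n) ((integral\<^sup>L lborel F - integral\<^sup>L lborel F) / s n)"
      unfolding D_def by (intro has_bochner_integral_divide_zero has_bochner_integral_diff shift)
        (use intF in \<open>auto simp: has_bochner_integral_iff\<close>)
    then show ?thesis by (simp add: has_bochner_integral_iff)
  qed
  have lim: "(\<lambda>n. D n x) \<longlonglongrightarrow> F' x v" for x
  proof -
    have "((\<lambda>a. F (x + a *\<^sub>R v)) has_real_derivative F' x v) (at 0)"
      by (rule has_real_derivative_along_line) (use F in simp)
    then have "((\<lambda>a. (F (x + a *\<^sub>R v) - F x) / a) \<longlongrightarrow> F' x v) (at 0)"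
      by (simp add: DERIV_def)
    moreover have "s \<longlonglongrightarrow> 0"
      unfolding s_def by (rule LIMSEQ_inverse_real_of_nat)
    moreover have "s n \<noteq> 0" for n
      using s(1)[of n] by simp
    ultimately show ?thesis
      unfolding D_def tendsto_at_iff_sequentially by (auto simp: o_def)
  qed
  \<comment> \<open>Dominating function: the mean value theorem bounds the quotient by
    \<open>B\<close>, and since \<open>s n\<close> is at most 1, both \<open>x\<close> and its shift
    miss \<open>K\<close> once \<open>norm x\<close> exceeds \<open>R + norm v\<close>.\<close>
  have bound: "norm (D n x) \<le> indicator (cball 0 (R + norm v)) x *\<^sub>R B" for n x
  proof (cases "x \<in> cball 0 (R + norm v)")
    case True
    have "((\<lambda>a. F (x + a *\<^sub>R v)) has_real_derivative F' (x + a *\<^sub>R v) v) (at a)" for a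
      by (rule has_real_derivative_along_line) (rule F)
    from MVT2[OF s(1) this] obtain a where "F (x + s n *\<^sub>R v) - F x = s n * F' (x + a *\<^sub>R v) v"
      by auto
    then show ?thesis
      using True s(1)[of n] B' by (simp add: D_def)
  next
    case False
    have "x \<notin> K"
      using R[of x] False norm_ge_zero[of v] by (auto simp del: norm_ge_zero)
    moreover have "x + s n *\<^sub>R v \<notin> K"
    proof
      assume "x + s n *\<^sub>R v \<in> K"
      then have "norm (x + s n *\<^sub>R v) \<le> R" by (rule R)
      moreover have "norm x \<le> norm (x + s n *\<^sub>R v) + norm (s n *\<^sub>R v)"
        using norm_triangle_ineq4[of "x + s n *\<^sub>R v" "s n *\<^sub>R v"] by simp
      moreover have "norm (s n *\<^sub>R v) \<le> norm v"
        using s[of n] mult_right_mono[of "s n" 1 "norm v"] by simp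
      ultimately show False using False by simp
    qed
    ultimately show ?thesis using False F0 by (simp add: D_def)
  qed
  have dom: "integrable lborel (\<lambda>x::'a. indicator (cball 0 (R + norm v)) x *\<^sub>R B)"
    by (rule borel_integrable_compact) auto
  have D[measurable]: "D n \<in> borel_measurable lborel" for n
    unfolding D_def by measurable
  have meas_lb: "(\<lambda>x. F' x v) \<in> borel_measurable lborel"
    by simp
  have ae: "AE x in lborel. (\<lambda>n. D n x) \<longlonglongrightarrow> F' x v"
    "AE x in lborel. norm (D n x) \<le> indicator (cball 0 (R + norm v)) x *\<^sub>R B" for n
    using lim bound by (blast intro: AE_I2)+
  have "integrable lborel (\<lambda>x. F' x v)"
    by (rule integrable_dominated_convergence[OF meas_lb D dom ae])
  moreover have "(\<lambda>n. integral\<^sup>L lborel (D n)) \<longlonglongrightarrow> integral\<^sup>L lborel (\<lambda>x. F' x v)"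
    by (rule integral_dominated_convergence[OF meas_lb D dom ae])
  then have "integral\<^sup>L lborel (\<lambda>x. F' x v) = 0"
    using intD by (simp add: LIMSEQ_const_iff)
  ultimately show ?thesis
    by (simp add: has_bochner_integral_iff)
qed

lemma linear_sum_Basis:
  fixes f :: "'a::euclidean_space \<Rightarrow> real"
  assumes "linear f"
  shows "(\<Sum>b\<in>Basis. (x \<bullet> b) * f b) = f x"
proof -
  have "f x = f (\<Sum>b\<in>Basis. (x \<bullet> b) *\<^sub>R b)"
    by (simp add: euclidean_representation)
  also have "\<dots> = (\<Sum>b\<in>Basis. (x \<bullet> b) * f b)"
    by (simp add: linear_sum[OF assms] linear_scale[OF assms])
  finally show ?thesis by simp
qed

text \<open>\<open>S\<close> and the complement of \<open>K\<close> form an open cover, and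
  \<open>h\<close> is zero on the second set. This extends continuity across the origin, where
  \<open>d\<close> is singular.\<close>

lemma continuous_on_UNIV_compact_support:
  fixes h :: "'a::t2_space \<Rightarrow> 'b::{topological_space,zero}"
  assumes "open S" "compact K" "K \<subseteq> S" "continuous_on S h" "\<And>x. x \<notin> K \<Longrightarrow> h x = 0"
  shows "continuous_on UNIV h"
proof -
  have "continuous_on (- K) h"
    using continuous_on_const[of "- K" 0] by (rule continuous_on_eq) (use assms in auto)
  then have "continuous_on (S \<union> - K) h"
    using assms by (intro continuous_on_open_Un) (auto intro: compact_imp_closed)
  moreover have "S \<union> - K = UNIV"
    using assms by auto
  ultimately show ?thesis by simp
qed

lemma integrable_compact_support:
  fixes h :: "'a::euclidean_space \<Rightarrow> real"
  assumes "compact K" "K \<subseteq> S" "continuous_on S h" "\<And>x. x \<notin> K \<Longrightarrow> h x = 0"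
  shows "integrable lborel h"
proof -
  have "integrable lborel (\<lambda>x. indicator K x *\<^sub>R h x)"
    using assms(1) continuous_on_subset[OF assms(3,2)] by (rule borel_integrable_compact)
  moreover have "(\<lambda>x. indicator K x *\<^sub>R h x) = h"
    using assms(4) by (auto simp: indicator_def fun_eq_iff)
  ultimately show ?thesis by simp
qed

text \<open>The integrand is the divergence of the compactly supported field
  \<open>\<phi> g (w + L)\<close>; the trace of \<open>L\<close> is the divergence of the affine
  factor. Each coordinate contributes one directional derivative, whose integral is zero.\<close>

lemma integration_by_parts_affine_field:
  fixes \<phi> g :: "'a::euclidean_space \<Rightarrow> real"
  assumes S: "open S" and K: "compact K" "K \<subseteq> S"
    and \<phi>0: "\<And>x. x \<notin> K \<Longrightarrow> \<phi> x = 0"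
    and \<phi>: "\<And>x. (\<phi> has_derivative \<phi>' x) (at x)"
    and \<phi>'cont: "\<And>v. continuous_on UNIV (\<lambda>x. \<phi>' x v)"
    and g: "\<And>x. x \<in> S \<Longrightarrow> (g has_derivative g' x) (at x)"
    and g'cont: "\<And>v. continuous_on S (\<lambda>x. g' x v)"
    and L: "linear L"
  shows "has_bochner_integral lborel
    (\<lambda>x. \<phi>' x (w + L x) * g x + \<phi> x * g' x (w + L x) + (\<Sum>b\<in>Basis. L b \<bullet> b) * \<phi> x * g x) 0"
proof -
  have bL: "bounded_linear L"
    using L by (rule linear_conv_bounded_linear[THEN iffD1])
  have \<phi>'0: "\<phi>' x v = 0" if "x \<notin> K" for x v
    using has_derivative_zero_off_closed[OF compact_imp_closed[OF K(1)] \<phi>0 that \<phi>] by blast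
  have gcont: "continuous_on S g"
    by (intro continuous_at_imp_continuous_on ballI has_derivative_continuous[OF g])
  have \<phi>cont: "continuous_on S \<phi>"
    by (intro continuous_at_imp_continuous_on ballI has_derivative_continuous[OF \<phi>])
  have Lcont: "continuous_on S L"
    using bL by (rule linear_continuous_on)
  define F where "F b x = \<phi> x * g x * ((w + L x) \<bullet> b)" for b x
  define F' where "F' b x v = (\<phi>' x v * g x + \<phi> x * g' x v) * ((w + L x) \<bullet> b) + \<phi> x * g x * (L v \<bullet> b)"
    for b x v
  have "has_bochner_integral lborel (\<lambda>x. F' b x b) 0" for b
  proof (rule integral_directional_derivative_0[where F = "F b" and F' = "F' b", OF K(1)])
    show "F b x = 0" if "x \<notin> K" for x
      using \<phi>0[OF that] by (simp add: F_def)
    show "(F b has_derivative F' b x) (at x)" for x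
    proof (cases "x \<in> S")
      case True
      show ?thesis
        unfolding F_def F'_def
        by (rule derivative_eq_intros \<phi> g[OF True] bounded_linear_imp_has_derivative[OF bL] refl ext)+
          (simp add: algebra_simps)
    next
      case False
      \<comment> \<open>Nothing is known about \<open>g\<close> outside \<open>S\<close>, but such a
        point lies in the open complement of \<open>K\<close>, where \<open>F b\<close> vanishes
        identically.\<close>
      then have x: "x \<in> - K" using K by auto
      have "((\<lambda>_. 0) has_derivative (\<lambda>_. 0)) (at x)"
        by simp
      then have "(F b has_derivative (\<lambda>_. 0)) (at x)"
        by (rule has_derivative_transform_within_open[of _ _ _ UNIV "- K"])
          (use K x \<phi>0 in \<open>auto simp: F_def intro: compact_imp_closed\<close>)
      moreover have "F' b x = (\<lambda>_. 0)"
        using x \<phi>0 \<phi>'0 by (auto simp: F'_def)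
      ultimately show ?thesis by simp
    qed
    show "continuous_on UNIV (\<lambda>x. F' b x b)"
    proof (rule continuous_on_UNIV_compact_support[OF S K])
      show "continuous_on S (\<lambda>x. F' b x b)"
        unfolding F'_def
        by (intro continuous_intros continuous_on_subset[OF \<phi>'cont] g'cont \<phi>cont gcont Lcont) auto
    qed (use \<phi>0 \<phi>'0 in \<open>auto simp: F'_def\<close>)
  qed
  then have "has_bochner_integral lborel (\<lambda>x. \<Sum>b\<in>Basis. F' b x b) (\<Sum>b\<in>(Basis :: 'a set). 0)"
    by (intro has_bochner_integral_sum)
  moreover have "(\<Sum>b\<in>Basis. F' b x b)
    = \<phi>' x (w + L x) * g x + \<phi> x * g' x (w + L x) + (\<Sum>b\<in>Basis. L b \<bullet> b) * \<phi> x * g x" for x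
  proof -
    have "(\<Sum>b\<in>Basis. F' b x b) = (\<Sum>b\<in>Basis. ((w + L x) \<bullet> b) * \<phi>' x b) * g x
      + \<phi> x * (\<Sum>b\<in>Basis. ((w + L x) \<bullet> b) * g' x b) + (\<Sum>b\<in>Basis. L b \<bullet> b) * \<phi> x * g x"
      by (simp only: F'_def sum.distrib[symmetric] sum_distrib_left sum_distrib_right)
        (intro sum.cong refl, simp add: algebra_simps)
    also have "(\<Sum>b\<in>Basis. ((w + L x) \<bullet> b) * \<phi>' x b) = \<phi>' x (w + L x)"
      by (rule linear_sum_Basis[OF has_derivative_linear[OF \<phi>]])
    also have "\<phi> x * (\<Sum>b\<in>Basis. ((w + L x) \<bullet> b) * g' x b) = \<phi> x * g' x (w + L x)"
    proof (cases "x \<in> S")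
      case True
      then show ?thesis
        by (simp add: linear_sum_Basis[OF has_derivative_linear[OF g]])
    next
      case False
      then show ?thesis using \<phi>0 K by auto
    qed
    finally show ?thesis .
  qed
  ultimately show ?thesis by simp
qed

section \<open>Derivatives along affine fields and their commutators\<close>

text \<open>
  The differential at \<open>y\<close> of the derivative \<open>f' y (w + L y)\<close> of \<open>f\<close> along an affine field;
  \<open>H b y v\<close> stands for the second derivative of \<open>f\<close> in the directions \<open>b\<close>, \<open>v\<close>.
\<close>

definition deriv_along :: "('a::euclidean_space \<Rightarrow> 'a \<Rightarrow> real) \<Rightarrow> ('a \<Rightarrow> 'a \<Rightarrow> 'a \<Rightarrow> real) \<Rightarrow>
    'a \<Rightarrow> ('a \<Rightarrow> 'a) \<Rightarrow> 'a \<Rightarrow> 'a \<Rightarrow> real" where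
  "deriv_along f' H w L y v = f' y (L v) + (\<Sum>b\<in>Basis. ((w + L y) \<bullet> b) * H b y v)"

text \<open>The hypothesis on \<open>H\<close> covers fixed directions only. Expanding the moving
  direction in the basis gives a finite sum of products, to which the product rule applies.\<close>

lemma has_derivative_along_affine_field:
  fixes f :: "'a::euclidean_space \<Rightarrow> real"
  assumes S: "open S" "y \<in> S"
    and f: "\<And>y. y \<in> S \<Longrightarrow> (f has_derivative f' y) (at y)"
    and H: "\<And>y b. y \<in> S \<Longrightarrow> ((\<lambda>z. f' z b) has_derivative H b y) (at y)"
    and L: "linear L"
  shows "((\<lambda>z. f' z (w + L z)) has_derivative deriv_along f' H w L y) (at y)"
proof -
  have bL: "bounded_linear L"
    using L by (rule linear_conv_bounded_linear[THEN iffD1])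
  have "((\<lambda>z. \<Sum>b\<in>Basis. ((w + L z) \<bullet> b) * f' z b) has_derivative
      (\<lambda>v. \<Sum>b\<in>Basis. ((w + L y) \<bullet> b) * H b y v + (L v \<bullet> b) * f' y b)) (at y)"
    by (rule derivative_eq_intros H[OF S(2)] bounded_linear_imp_has_derivative[OF bL] refl ext)+ simp
  moreover have "(\<lambda>v. \<Sum>b\<in>Basis. ((w + L y) \<bullet> b) * H b y v + (L v \<bullet> b) * f' y b)
      = deriv_along f' H w L y"
    using linear_sum_Basis[OF has_derivative_linear[OF f[OF S(2)]]]
    by (simp add: fun_eq_iff deriv_along_def sum.distrib)
  ultimately have "((\<lambda>z. \<Sum>b\<in>Basis. ((w + L z) \<bullet> b) * f' z b) has_derivative deriv_along f' H w L y) (at y)"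
    by simp
  then show ?thesis
    by (rule has_derivative_transform_within_open[OF _ S])
      (rule linear_sum_Basis[OF has_derivative_linear[OF f]])
qed

lemma continuous_on_deriv_along:
  assumes "\<And>b. continuous_on S (\<lambda>y. f' y b)" "\<And>b c. continuous_on S (\<lambda>y. H b y c)" "linear L"
  shows "continuous_on S (\<lambda>y. deriv_along f' H w L y v)"
  unfolding deriv_along_def
  using assms(3) by (intro continuous_intros assms(1,2) linear_continuous_on linear_conv_bounded_linear[THEN iffD1])

text \<open>The second-order terms of the two iterated derivatives cancel by symmetry; what remains
  is the derivative along the Lie bracket of the two affine fields.\<close>

lemma deriv_along_commutator:
  assumes symm: "\<And>b c. H b y c = H c y b"
    and H: "\<And>b. linear (H b y)"
  shows "deriv_along f' H w L y (w' + L' y) - deriv_along f' H w' L' y (w + L y)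
    = f' y (L (w' + L' y)) - f' y (L' (w + L y))"
proof -
  \<comment> \<open>Expansion in both arguments lets the symmetry of \<open>H\<close> be used on
    pairs of basis vectors.\<close>
  have expand: "(\<Sum>b\<in>Basis. (p \<bullet> b) * H b y q) = (\<Sum>b\<in>Basis. \<Sum>c\<in>Basis. (p \<bullet> b) * ((q \<bullet> c) * H b y c))"
    for p q
    by (simp only: sum_distrib_left[symmetric] linear_sum_Basis[OF H])
  have "(\<Sum>b\<in>Basis. (p \<bullet> b) * H b y q) = (\<Sum>b\<in>Basis. (q \<bullet> b) * H b y p)" for p q
    unfolding expand[of p q] expand[of q p]
    by (subst sum.swap) (intro sum.cong refl, simp add: symm[of _ _] mult_ac)
  then show ?thesis
    by (simp add: deriv_along_def)
qed

section \<open>Traces in the coordinates of the group\<close>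

lemma sum_Basis_vec:
  "(\<Sum>b\<in>(Basis :: (real^'n) set). F b) = (\<Sum>i\<in>UNIV. F (axis i 1))"
proof -
  have eq: "(Basis :: (real^'n) set) = (\<lambda>i. axis i 1) ` UNIV"
    by (auto simp: Basis_vec_def)
  have inj: "inj (\<lambda>i::'n. axis i (1::real))"
    by (auto simp: inj_on_def axis_eq_axis)
  show ?thesis
    unfolding eq sum.reindex[OF inj] by simp
qed

lemma sum_Basis_prod:
  "(\<Sum>b\<in>(Basis :: ('a::euclidean_space \<times> 'b::euclidean_space) set). F b)
    = (\<Sum>b\<in>Basis. F (b, 0)) + (\<Sum>b\<in>Basis. F (0, b))"
proof -
  have inj: "inj_on (\<lambda>u. (u::'a, 0::'b)) Basis" "inj_on (\<lambda>u. (0::'a, u::'b)) Basis"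
    by (auto simp: inj_on_def)
  show ?thesis
    unfolding Basis_prod_def
    by (subst sum.union_disjoint) (auto simp: sum.reindex inj)
qed

lemma trace_pt:
  fixes L :: "('n::finite, 'h::finite) pt \<Rightarrow> ('n, 'h) pt"
  shows "(\<Sum>b\<in>Basis. L b \<bullet> b) = (\<Sum>i\<in>UNIV. fst (fst (L ((axis i 1, 0), 0))) $ i)
    + (\<Sum>i\<in>UNIV. snd (fst (L ((0, axis i 1), 0))) $ i) + (\<Sum>j\<in>UNIV. snd (L (0, axis j 1)) $ j)"
  by (simp add: sum_Basis_prod sum_Basis_vec inner_prod_def inner_axis)

section \<open>The horizontal fields as affine vector fields\<close>

text \<open>X_{2i-1} and X_{2i} are split into a constant vector and a linear map of the point, the
  form \<open>w + L P\<close> in which integration by parts and the commutator formula are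
  stated.\<close>

definition odd_base :: "'n \<Rightarrow> ('n::finite, 'h::finite) pt" where
  "odd_base i = ((axis i 1, 0), 0)"

definition odd_lin :: "('h \<Rightarrow> 'n \<Rightarrow> real) \<Rightarrow> 'n \<Rightarrow> ('n::finite, 'h::finite) pt \<Rightarrow> ('n, 'h) pt" where
  "odd_lin lam i P = (0, \<chi> j. lam j i / 2 * snd (fst P) $ i)"

definition even_base :: "'n \<Rightarrow> ('n::finite, 'h::finite) pt" where
  "even_base i = ((0, axis i 1), 0)"

definition even_lin :: "('h \<Rightarrow> 'n \<Rightarrow> real) \<Rightarrow> 'n \<Rightarrow> ('n::finite, 'h::finite) pt \<Rightarrow> ('n, 'h) pt" where
  "even_lin lam i P = (0, \<chi> j. - (lam j i / 2 * fst (fst P) $ i))"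

definition odd_field :: "('h \<Rightarrow> 'n \<Rightarrow> real) \<Rightarrow> 'n \<Rightarrow> ('n::finite, 'h::finite) pt \<Rightarrow> ('n, 'h) pt" where
  "odd_field lam i P = odd_base i + odd_lin lam i P"

definition even_field :: "('h \<Rightarrow> 'n \<Rightarrow> real) \<Rightarrow> 'n \<Rightarrow> ('n::finite, 'h::finite) pt \<Rightarrow> ('n, 'h) pt" where
  "even_field lam i P = even_base i + even_lin lam i P"

text \<open>
  The indices \<open>i_k\<close> are distinct when \<open>A\<close> is invertible, but counting their multiplicities makes it
  unnecessary to use this.
\<close>

definition mult_ix :: "('h::finite \<Rightarrow> 'n) \<Rightarrow> 'n \<Rightarrow> real" where
  "mult_ix ix i = (\<Sum>k\<in>UNIV. if ix k = i then 1 else 0)"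

text \<open>The horizontal field with coefficients z + \<Sum>_k z^(i_k). Its vertical component is
  zero because the contributions of X_{2i-1} and X_{2i} cancel in each plane.\<close>

definition weighted_field :: "('h \<Rightarrow> 'n) \<Rightarrow> ('n::finite, 'h::finite) pt \<Rightarrow> ('n, 'h) pt" where
  "weighted_field ix P = ((\<chi> i. (1 + mult_ix ix i) * fst (fst P) $ i,
     \<chi> i. (1 + mult_ix ix i) * snd (fst P) $ i), 0)"

text \<open>The generator of the dilations, that is, the derivative of \<open>dil \<gamma> P\<close>
  in \<gamma> at 1.\<close>

definition euler_field :: "('n::finite, 'h::finite) pt \<Rightarrow> ('n, 'h) pt" where
  "euler_field P = (fst P, 2 *\<^sub>R snd P)"

lemma linear_odd_lin: "linear (odd_lin lam i)"
  by (rule linearI) (auto simp: odd_lin_def vec_eq_iff algebra_simps zero_prod_def)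

lemma linear_even_lin: "linear (even_lin lam i)"
  by (rule linearI) (auto simp: even_lin_def vec_eq_iff algebra_simps zero_prod_def)

lemma linear_weighted_field: "linear (weighted_field ix)"
  by (rule linearI) (auto simp: weighted_field_def vec_eq_iff algebra_simps)

text \<open>The horizontal fields are divergence free: their vertical coefficients depend on the
  horizontal coordinates only.\<close>

lemma trace_odd_lin: "(\<Sum>b\<in>Basis. odd_lin lam i b \<bullet> b) = 0"
  unfolding trace_pt by (simp add: odd_lin_def)

lemma trace_even_lin: "(\<Sum>b\<in>Basis. even_lin lam i b \<bullet> b) = 0"
  unfolding trace_pt by (simp add: even_lin_def)

lemma sum_mult_ix: "(\<Sum>i\<in>UNIV. mult_ix (ix :: 'h::finite \<Rightarrow> 'n::finite) i) = real CARD('h)"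
  unfolding mult_ix_def by (subst sum.swap) simp

text \<open>The source of Q: each plane contributes \<open>2 * (1 + mult_ix ix i)\<close>, and the
  multiplicities add up to h.\<close>

lemma trace_weighted_field:
  fixes ix :: "'h::finite \<Rightarrow> 'n::finite"
  shows "(\<Sum>b\<in>Basis. weighted_field ix b \<bullet> b) = real (2 * CARD('n) + 2 * CARD('h))"
  unfolding trace_pt by (simp add: weighted_field_def sum.distrib sum_mult_ix)

lemma vec_conv_sum_axis: "(\<chi> j. c j) = (\<Sum>j\<in>UNIV. c j *\<^sub>R axis j (1::real))"
  by (simp add: vec_eq_iff axis_def if_distrib[where f = "\<lambda>x. _ * x"] cong: if_cong)

lemma snd_conv_sum: "(0, \<chi> j. c j) = (\<Sum>j\<in>UNIV. c j *\<^sub>R ((0, axis j 1) :: ('n::finite, 'h::finite) pt))"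
  by (simp add: prod_eq_iff vec_conv_sum_axis fst_sum snd_sum)

lemma linear_odd_field:
  assumes "linear D"
  shows "D (odd_field lam i P) = D ((axis i 1, 0), 0)
    + (\<Sum>j\<in>UNIV. lam j i / 2 * snd (fst P) $ i * D ((0, 0), axis j 1))"
  unfolding odd_field_def odd_base_def odd_lin_def snd_conv_sum
  by (simp only: linear_add[OF assms] linear_sum[OF assms] linear_scale[OF assms] zero_prod_def real_scaleR_def)

lemma linear_even_field:
  assumes "linear D"
  shows "D (even_field lam i P) = D ((0, axis i 1), 0)
    - (\<Sum>j\<in>UNIV. lam j i / 2 * fst (fst P) $ i * D ((0, 0), axis j 1))"
  unfolding even_field_def even_base_def even_lin_def snd_conv_sum
  by (simp only: linear_add[OF assms] linear_sum[OF assms] linear_scale[OF assms] zero_prod_def real_scaleR_def)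
    (simp add: sum_negf)

lemma rotation_free_part:
  "fst (fst P) $ i *\<^sub>R odd_field lam i P + snd (fst P) $ i *\<^sub>R even_field lam i P
     = ((axis i (fst (fst P) $ i), axis i (snd (fst P) $ i)), 0)"
  by (auto simp: odd_field_def even_field_def odd_base_def even_base_def odd_lin_def even_lin_def
      prod_eq_iff vec_eq_iff axis_def)

lemma weighted_field_conv_sum:
  "weighted_field ix P = (\<Sum>i\<in>UNIV. (1 + mult_ix ix i) *\<^sub>R
     (fst (fst P) $ i *\<^sub>R odd_field lam i P + snd (fst P) $ i *\<^sub>R even_field lam i P))"
  unfolding rotation_free_part
  by (auto simp: weighted_field_def prod_eq_iff vec_eq_iff fst_sum snd_sum axis_def
      if_distrib[where f = "\<lambda>x. _ * x"] cong: if_cong)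

text \<open>Separates the horizontal Euler part from the sum over \<open>k\<close>, which is the
  part that cancels in \<open>divergence_algebra\<close>.\<close>

lemma weighted_field_conv:
  "weighted_field ix P = (fst P, 0) + (\<Sum>k\<in>UNIV.
     fst (fst P) $ ix k *\<^sub>R odd_field lam (ix k) P + snd (fst P) $ ix k *\<^sub>R even_field lam (ix k) P)"
  unfolding rotation_free_part
  by (auto simp: weighted_field_def mult_ix_def prod_eq_iff vec_eq_iff fst_sum snd_sum axis_def
      sum_distrib_right distrib_right intro!: sum.cong)

lemma euler_field_conv:
  "euler_field P = (fst P, 0) + (\<Sum>j\<in>UNIV. (2 * snd P $ j) *\<^sub>R (0, axis j 1))"
  by (auto simp: euler_field_def prod_eq_iff vec_eq_iff fst_sum snd_sum axis_def
      if_distrib[where f = "\<lambda>x. _ * x"] cong: if_cong)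

text \<open>By \<open>deriv_along_commutator\<close>, this is the bracket [X_{2i}, X_{2i-1}], a
  vertical field with constant coefficients.\<close>

lemma even_odd_commutator_field:
  "odd_lin lam i (even_field lam i P) - even_lin lam i (odd_field lam i P) = (0, \<chi> l. lam l i)"
  by (auto simp: odd_field_def even_field_def odd_base_def even_base_def odd_lin_def even_lin_def
      prod_eq_iff vec_eq_iff)

section \<open>The divergence of the weighted field\<close>

text \<open>With \<open>D\<close> the differential of \<open>f\<close> at \<open>P\<close>, the
  products \<open>B A = 1\<close> and \<open>A B = 1\<close> act separately. The first turns the
  commutator terms into 2 t_j times the derivative along t_j, the vertical Euler part. The diagonal
  of the second turns the derivatives of t_j along the fields into \<open>- D (R k)\<close>, which
  removes the extra part of \<open>weighted_field\<close>.\<close>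

lemma divergence_algebra:
  fixes D :: "('n::finite, 'h::finite) pt \<Rightarrow> real" and lam :: "'h \<Rightarrow> 'n \<Rightarrow> real"
  assumes D: "linear D"
    and BA: "\<And>j l. (\<Sum>k\<in>UNIV. B j k * lam l (ix k)) = (if j = l then 1 else 0)"
    and AB: "\<And>k. (\<Sum>j\<in>UNIV. lam j (ix k) * B j k) = 1"
  shows "D (weighted_field ix P) + (\<Sum>j\<in>UNIV. \<Sum>k\<in>UNIV. 2 * B j k *
      (snd (even_field lam (ix k) P) $ j * D (odd_field lam (ix k) P)
       - snd (odd_field lam (ix k) P) $ j * D (even_field lam (ix k) P)
       + snd P $ j * D (0, \<chi> l. lam l (ix k)))) = D (euler_field P)"
proof -
  define R where "R k = fst (fst P) $ ix k *\<^sub>R odd_field lam (ix k) P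
    + snd (fst P) $ ix k *\<^sub>R even_field lam (ix k) P" for k
  have DR: "D (R k) = fst (fst P) $ ix k * D (odd_field lam (ix k) P)
    + snd (fst P) $ ix k * D (even_field lam (ix k) P)" for k
    by (simp add: R_def linear_add[OF D] linear_scale[OF D])
  have T: "(\<Sum>k\<in>UNIV. B j k * D (0, \<chi> l. lam l (ix k))) = D (0, axis j 1)" for j
  proof -
    have "(\<Sum>k\<in>UNIV. B j k *\<^sub>R ((0, \<chi> l. lam l (ix k)) :: ('n, 'h) pt)) = (0, axis j 1)"
      using BA by (auto simp: prod_eq_iff vec_eq_iff fst_sum snd_sum axis_def)
    then have "D (0, axis j 1) = D (\<Sum>k\<in>UNIV. B j k *\<^sub>R (0, \<chi> l. lam l (ix k)))"
      by simp
    then show ?thesis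
      by (simp only: linear_sum[OF D] linear_scale[OF D] real_scaleR_def)
  qed
  have "(\<Sum>j\<in>UNIV. \<Sum>k\<in>UNIV. 2 * B j k *
      (snd (even_field lam (ix k) P) $ j * D (odd_field lam (ix k) P)
       - snd (odd_field lam (ix k) P) $ j * D (even_field lam (ix k) P)
       + snd P $ j * D (0, \<chi> l. lam l (ix k))))
    = (\<Sum>j\<in>UNIV. \<Sum>k\<in>UNIV. 2 * snd P $ j * (B j k * D (0, \<chi> l. lam l (ix k)))
        - lam j (ix k) * B j k * D (R k))"
    by (intro sum.cong refl)
      (simp add: DR even_field_def odd_field_def even_base_def odd_base_def even_lin_def odd_lin_def
        algebra_simps)
  also have "\<dots> = (\<Sum>j\<in>UNIV. 2 * snd P $ j * (\<Sum>k\<in>UNIV. B j k * D (0, \<chi> l. lam l (ix k))))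
      - (\<Sum>k\<in>UNIV. (\<Sum>j\<in>UNIV. lam j (ix k) * B j k) * D (R k))"
    unfolding sum_subtractf sum_distrib_left sum_distrib_right
    by (subst (4) sum.swap) (rule refl)
  also have "\<dots> = (\<Sum>j\<in>UNIV. 2 * snd P $ j * D (0, axis j 1)) - (\<Sum>k\<in>UNIV. D (R k))"
    by (simp add: T AB)
  finally show ?thesis
    by (simp add: weighted_field_conv[of ix P lam] euler_field_conv R_def[symmetric] linear_add[OF D]
        linear_sum[OF D] linear_scale[OF D] del: scaleR_Pair)
qed

text \<open>The integrand is the divergence of \<phi> times the field made of \<open>f\<close> times
  \<open>weighted_field\<close> and the rotated gradients of \<open>f\<close> weighted by
  \<open>2 * B j k * t_j\<close>. Integration by parts is applied to each piece, and
  \<open>divergence_algebra\<close> sums up the derivatives of \<open>f\<close>.\<close>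

lemma integral_divergence_identity:
  fixes f \<phi> :: "('n::finite, 'h::finite) pt \<Rightarrow> real" and lam :: "'h \<Rightarrow> 'n \<Rightarrow> real"
  assumes S: "open S" and K: "compact K" "K \<subseteq> S"
    and \<phi>0: "\<And>x. x \<notin> K \<Longrightarrow> \<phi> x = 0"
    and \<phi>: "\<And>x. (\<phi> has_derivative \<phi>' x) (at x)"
    and \<phi>'cont: "\<And>v. continuous_on UNIV (\<lambda>x. \<phi>' x v)"
    and f: "\<And>x. x \<in> S \<Longrightarrow> (f has_derivative f' x) (at x)"
    and H: "\<And>x b. x \<in> S \<Longrightarrow> ((\<lambda>z. f' z b) has_derivative H b x) (at x)"
    and Hcont: "\<And>b c. continuous_on S (\<lambda>x. H b x c)"
    and BA: "\<And>j l. (\<Sum>k\<in>UNIV. B j k * lam l (ix k)) = (if j = l then 1 else 0)"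
    and AB: "\<And>k. (\<Sum>j\<in>UNIV. lam j (ix k) * B j k) = 1"
  shows "has_bochner_integral lborel (\<lambda>P. f P * \<phi>' P (weighted_field ix P)
      + (\<Sum>j\<in>UNIV. \<Sum>k\<in>UNIV. 2 * B j k * snd P $ j *
          (f' P (odd_field lam (ix k) P) * \<phi>' P (even_field lam (ix k) P)
           - f' P (even_field lam (ix k) P) * \<phi>' P (odd_field lam (ix k) P)))
      + \<phi> P * (real (2 * CARD('n) + 2 * CARD('h)) * f P + f' P (euler_field P))) 0"
proof -
  have f'cont: "continuous_on S (\<lambda>x. f' x v)" for v
    by (intro continuous_at_imp_continuous_on ballI has_derivative_continuous[OF H])
  have symm: "H b x c = H c x b" if "x \<in> S" for b c x
    by (rule second_derivative_symmetric[OF S that f H Hcont])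
  define Do where "Do k = deriv_along f' H (odd_base (ix k)) (odd_lin lam (ix k))" for k
  define De where "De k = deriv_along f' H (even_base (ix k)) (even_lin lam (ix k))" for k
  have Do: "((\<lambda>z. f' z (odd_field lam (ix k) z)) has_derivative Do k x) (at x)" if "x \<in> S" for k x
    unfolding odd_field_def Do_def
    by (rule has_derivative_along_affine_field[OF S that f H linear_odd_lin])
  have De: "((\<lambda>z. f' z (even_field lam (ix k) z)) has_derivative De k x) (at x)" if "x \<in> S" for k x
    unfolding even_field_def De_def
    by (rule has_derivative_along_affine_field[OF S that f H linear_even_lin])
  have Docont: "continuous_on S (\<lambda>x. Do k x v)" for k v
    unfolding Do_def by (rule continuous_on_deriv_along[OF f'cont Hcont linear_odd_lin])
  have Decont: "continuous_on S (\<lambda>x. De k x v)" for k v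
    unfolding De_def by (rule continuous_on_deriv_along[OF f'cont Hcont linear_even_lin])
  have comm: "Do k x (even_field lam (ix k) x) - De k x (odd_field lam (ix k) x)
      = f' x (0, \<chi> l. lam l (ix k))" if x: "x \<in> S" for k x
  proof -
    have "Do k x (even_field lam (ix k) x) - De k x (odd_field lam (ix k) x)
      = f' x (odd_lin lam (ix k) (even_field lam (ix k) x))
        - f' x (even_lin lam (ix k) (odd_field lam (ix k) x))"
      unfolding Do_def De_def odd_field_def even_field_def
      by (rule deriv_along_commutator) (use symm[OF x] has_derivative_linear[OF H[OF x]] in auto)
    then show ?thesis
      by (simp add: linear_diff[OF has_derivative_linear[OF f[OF x]], symmetric] even_odd_commutator_field)
  qed
  have fieldcont: "continuous_on S (\<lambda>z. f' z (odd_field lam (ix k) z))"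
      "continuous_on S (\<lambda>z. f' z (even_field lam (ix k) z))" for k
    by (intro continuous_at_imp_continuous_on ballI has_derivative_continuous[OF Do]
        has_derivative_continuous[OF De]; assumption)+
  have tderiv: "((\<lambda>P. snd P $ j) has_derivative (\<lambda>v. snd v $ j)) (at x)" for j and x :: "('n, 'h) pt"
    by (auto intro!: derivative_eq_intros bounded_linear.has_derivative[OF bounded_linear_vec_nth])
  note ibp = integration_by_parts_affine_field[OF S K \<phi>0 \<phi> \<phi>'cont]
  have I0: "has_bochner_integral lborel (\<lambda>P. \<phi>' P (0 + weighted_field ix P) * f P
      + \<phi> P * f' P (0 + weighted_field ix P) + (\<Sum>b\<in>Basis. weighted_field ix b \<bullet> b) * \<phi> P * f P) 0"
    by (rule ibp[OF _ f f'cont linear_weighted_field])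
  \<comment> \<open>The two halves of a rotated gradient: t_j X_{2i-1} f along X_{2i}, then the same
    with the fields exchanged. In the difference, the second derivatives of \<open>f\<close> form
    the commutator \<open>comm\<close>.\<close>
  have I1: "has_bochner_integral lborel (\<lambda>P. \<phi>' P (even_base (ix k) + even_lin lam (ix k) P)
        * (snd P $ j * f' P (odd_field lam (ix k) P))
      + \<phi> P * (\<lambda>v. snd P $ j * Do k P v + snd v $ j * f' P (odd_field lam (ix k) P))
          (even_base (ix k) + even_lin lam (ix k) P)
      + (\<Sum>b\<in>Basis. even_lin lam (ix k) b \<bullet> b) * \<phi> P * (snd P $ j * f' P (odd_field lam (ix k) P))) 0"
    for j k
    by (rule ibp[where g' = "\<lambda>P v. snd P $ j * Do k P v + snd v $ j * f' P (odd_field lam (ix k) P)"])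
      (auto intro!: has_derivative_mult tderiv Do linear_even_lin continuous_intros Docont fieldcont)
  have I2: "has_bochner_integral lborel (\<lambda>P. \<phi>' P (odd_base (ix k) + odd_lin lam (ix k) P)
        * (snd P $ j * f' P (even_field lam (ix k) P))
      + \<phi> P * (\<lambda>v. snd P $ j * De k P v + snd v $ j * f' P (even_field lam (ix k) P))
          (odd_base (ix k) + odd_lin lam (ix k) P)
      + (\<Sum>b\<in>Basis. odd_lin lam (ix k) b \<bullet> b) * \<phi> P * (snd P $ j * f' P (even_field lam (ix k) P))) 0"
    for j k
    by (rule ibp[where g' = "\<lambda>P v. snd P $ j * De k P v + snd v $ j * f' P (even_field lam (ix k) P)"])
      (auto intro!: has_derivative_mult tderiv De linear_odd_lin continuous_intros Decont fieldcont)
  define G0 where "G0 P = \<phi>' P (weighted_field ix P) * f P + \<phi> P * f' P (weighted_field ix P)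
      + real (2 * CARD('n) + 2 * CARD('h)) * \<phi> P * f P" for P
  define G1 where "G1 j k P = \<phi>' P (even_field lam (ix k) P) * (snd P $ j * f' P (odd_field lam (ix k) P))
      + \<phi> P * (snd P $ j * Do k P (even_field lam (ix k) P)
          + snd (even_field lam (ix k) P) $ j * f' P (odd_field lam (ix k) P))" for j k P
  define G2 where "G2 j k P = \<phi>' P (odd_field lam (ix k) P) * (snd P $ j * f' P (even_field lam (ix k) P))
      + \<phi> P * (snd P $ j * De k P (odd_field lam (ix k) P)
          + snd (odd_field lam (ix k) P) $ j * f' P (even_field lam (ix k) P))" for j k P
  have J: "has_bochner_integral lborel G0 0" "has_bochner_integral lborel (G1 j k) 0"
    "has_bochner_integral lborel (G2 j k) 0" for j k
    using I0 I1[of k j] I2[of k j]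
    unfolding trace_weighted_field trace_odd_lin trace_even_lin odd_field_def[symmetric]
      even_field_def[symmetric] G0_def[abs_def] G1_def[abs_def] G2_def[abs_def]
    by simp_all
  have "has_bochner_integral lborel (\<lambda>P. G0 P + (\<Sum>j\<in>UNIV. \<Sum>k\<in>UNIV. 2 * B j k * (G1 j k P - G2 j k P)))
      (0 + (\<Sum>j\<in>(UNIV::'h set). \<Sum>k\<in>(UNIV::'h set). 2 * B j k * (0 - 0)))"
    by (intro has_bochner_integral_add has_bochner_integral_sum has_bochner_integral_mult_right
        has_bochner_integral_diff J)
  moreover have "G0 P + (\<Sum>j\<in>UNIV. \<Sum>k\<in>UNIV. 2 * B j k * (G1 j k P - G2 j k P))
    = f P * \<phi>' P (weighted_field ix P)
      + (\<Sum>j\<in>UNIV. \<Sum>k\<in>UNIV. 2 * B j k * snd P $ j *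
          (f' P (odd_field lam (ix k) P) * \<phi>' P (even_field lam (ix k) P)
           - f' P (even_field lam (ix k) P) * \<phi>' P (odd_field lam (ix k) P)))
      + \<phi> P * (real (2 * CARD('n) + 2 * CARD('h)) * f P + f' P (euler_field P))" for P
  proof -
    have E: "\<phi> P * f' P (euler_field P) = \<phi> P * (f' P (weighted_field ix P) + (\<Sum>j\<in>UNIV. \<Sum>k\<in>UNIV. 2 * B j k *
      (snd (even_field lam (ix k) P) $ j * f' P (odd_field lam (ix k) P)
       - snd (odd_field lam (ix k) P) $ j * f' P (even_field lam (ix k) P)
       + snd P $ j * (Do k P (even_field lam (ix k) P) - De k P (odd_field lam (ix k) P)))))"
    proof (cases "P \<in> S")
      case True
      show ?thesis
        unfolding comm[OF True] divergence_algebra[OF has_derivative_linear[OF f[OF True]] BA AB] ..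
    next
      \<comment> \<open>Off \<open>S\<close> there is no control of \<open>f'\<close>, but the
        common factor \<phi> is zero.\<close>
      case False
      then have "\<phi> P = 0" using \<phi>0 K by blast
      then show ?thesis by simp
    qed
    show ?thesis
      unfolding distrib_left[of "\<phi> P"] E
      by (simp add: G0_def G1_def G2_def algebra_simps sum.distrib sum_subtractf sum_distrib_left)
  qed
  ultimately show ?thesis by simp
qed

section \<open>The field \<open>Z_d\<close> and the norm \<open>d\<close>\<close>

lemma matrix_inv_inverse:
  assumes "invertible A"
  shows "A ** matrix_inv A = mat 1 \<and> matrix_inv A ** A = mat 1"
  using assms unfolding invertible_def matrix_inv_def by (rule someI_ex)

text \<open>For \<open>q = p - 1\<close> this is, up to the factor \<open>p\<close>, the derivative
  of the function \<open>\<bar>x\<bar> powr p\<close>.\<close>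

definition signed_powr :: "real \<Rightarrow> real \<Rightarrow> real" where
  "signed_powr q x = sgn x * \<bar>x\<bar> powr q"

lemma signed_powr_zero [simp]: "signed_powr q 0 = 0"
  by (simp add: signed_powr_def)

lemma abs_signed_powr [simp]: "\<bar>signed_powr q x\<bar> = \<bar>x\<bar> powr q"
  by (simp add: signed_powr_def abs_mult sgn_if)

lemma continuous_on_signed_powr:
  assumes "0 < q"
  shows "continuous_on S (signed_powr q)"
proof -
  \<comment> \<open>Powers of the positive and the negative part are continuous also at 0, since the
    exponent is positive.\<close>
  have "continuous_on S (\<lambda>x. max x 0 powr q - max (- x) 0 powr q)"
    using assms by (intro continuous_intros continuous_on_powr') auto
  moreover have "(\<lambda>x. max x 0 powr q - max (- x) 0 powr q) = signed_powr q"
    by (auto simp: signed_powr_def max_def sgn_if fun_eq_iff)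
  ultimately show ?thesis by (simp only:)
qed

lemma has_real_derivative_abs_powr:
  assumes "1 < p"
  shows "((\<lambda>x. \<bar>x\<bar> powr p) has_real_derivative p * signed_powr (p - 1) x) (at x)"
proof -
  consider "0 < x" | "x < 0" | "x = 0" by linarith
  then show ?thesis
  proof cases
    case 1
    have "((\<lambda>x. x powr p) has_real_derivative p * signed_powr (p - 1) x) (at x)"
      using 1 by (auto intro!: derivative_eq_intros simp: signed_powr_def)
    then show ?thesis
      by (rule has_field_derivative_transform_within_open[of _ _ _ "{0<..}"]) (use 1 in auto)
  next
    case 2
    have "((\<lambda>x. (- x) powr p) has_real_derivative p * signed_powr (p - 1) x) (at x)"
      using 2 by (auto intro!: derivative_eq_intros simp: signed_powr_def)
    then show ?thesis
      by (rule has_field_derivative_transform_within_open[of _ _ _ "{..<0}"]) (use 2 in auto)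
  next
    case 3
    \<comment> \<open>At 0 the difference quotient is itself a signed power of exponent
      \<open>p - 1 > 0\<close>, hence tends to 0.\<close>
    have "(\<lambda>h. \<bar>h\<bar> powr p / h) = signed_powr (p - 1)"
      by (auto simp: signed_powr_def fun_eq_iff powr_diff sgn_if)
    moreover have "isCont (signed_powr (p - 1)) 0"
      using continuous_on_signed_powr[of "p - 1" UNIV] assms
      by (simp add: continuous_on_eq_continuous_at)
    then have "signed_powr (p - 1) \<midarrow>0\<rightarrow> 0"
      by (simp add: isCont_def)
    ultimately show ?thesis
      using 3 by (simp add: DERIV_def)
  qed
qed

lemma powr_young:
  fixes x y p :: real
  assumes "1 < p" "0 \<le> x" "0 \<le> y"
  shows "x powr (p - 1) * y \<le> (1 - 1 / p) * x powr p + y powr p / p"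
proof -
  have "y * x powr (p - 1) \<le> y powr p / p + (x powr (p - 1)) powr (p / (p - 1)) / (p / (p - 1))"
    by (rule Youngs_inequality) (use assms in \<open>auto simp: field_simps\<close>)
  also have "(x powr (p - 1)) powr (p / (p - 1)) = x powr p"
    using assms by (simp add: powr_powr)
  also have "x powr p / (p / (p - 1)) = (1 - 1 / p) * x powr p"
    using assms by (simp add: field_simps)
  finally show ?thesis by (simp add: algebra_simps)
qed

lemma sum_select_ix:
  fixes a F :: "'n::finite \<Rightarrow> real" and ix :: "'h::finite \<Rightarrow> 'n"
  shows "(\<Sum>i\<in>UNIV. a i * (\<Sum>j\<in>J. \<Sum>k\<in>UNIV. c j k * (if ix k = i then F i else 0)))
    = (\<Sum>j\<in>J. \<Sum>k\<in>UNIV. c j k * (a (ix k) * F (ix k)))"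
proof -
  have "(\<Sum>i\<in>UNIV. a i * (\<Sum>j\<in>J. \<Sum>k\<in>UNIV. c j k * (if ix k = i then F i else 0)))
    = (\<Sum>j\<in>J. \<Sum>k\<in>UNIV. \<Sum>i\<in>UNIV. a i * (c j k * (if ix k = i then F i else 0)))"
    unfolding sum_distrib_left
    by (subst sum.swap, rule sum.cong[OF refl], rule sum.swap)
  also have "\<dots> = (\<Sum>j\<in>J. \<Sum>k\<in>UNIV. c j k * (a (ix k) * F (ix k)))"
    by (intro sum.cong refl)
      (simp add: if_distrib[where f = "\<lambda>x. _ * x"] mult_ac cong: if_cong)
  finally show ?thesis .
qed

section \<open>The pairing with \<open>Z_d\<close>, homogeneity and regularity\<close>

text \<open>Collecting the terms of each plane exposes the antisymmetric expression in the
  horizontal derivatives of \<open>d\<close> and \<open>u\<close> that comes from the rotated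
  gradient.\<close>

lemma gradZ_conv:
  fixes d u :: "('n::finite, 'h::finite) pt \<Rightarrow> real"
  shows "gradZ lam ix p \<theta> d u P =
    (\<Sum>i\<in>UNIV. (1 + mult_ix ix i) *
       (fst (fst P) $ i * Xodd lam i u P + snd (fst P) $ i * Xeven lam i u P)) / d P
    - 2 * p * \<theta> * (\<Sum>j\<in>UNIV. \<Sum>k\<in>UNIV.
        matrix_inv (Amat lam ix) $ j $ k * snd P $ j / (d P)\<^sup>2 *
        (Xodd lam (ix k) d P * Xeven lam (ix k) u P - Xeven lam (ix k) d P * Xodd lam (ix k) u P))"
proof -
  define c where "c j k = matrix_inv (Amat lam ix) $ j $ k * snd P $ j / (d P)\<^sup>2" for j k
  have m: "(\<Sum>k\<in>UNIV. if ix k = i then r else 0) = mult_ix ix i * r" for i r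
    by (simp add: mult_ix_def sum_distrib_right if_distrib[where f = "\<lambda>x. x * _"] cong: if_cong)
  define So where "So i = (\<Sum>j\<in>UNIV. \<Sum>k\<in>UNIV. c j k * (if ix k = i then - Xeven lam i d P else 0))" for i
  define Se where "Se i = (\<Sum>j\<in>UNIV. \<Sum>k\<in>UNIV. c j k * (if ix k = i then Xodd lam i d P else 0))" for i
  have "gradZ lam ix p \<theta> d u P =
      (\<Sum>i\<in>UNIV. (1 + mult_ix ix i) *
         (fst (fst P) $ i * Xodd lam i u P + snd (fst P) $ i * Xeven lam i u P)) / d P
      - 2 * p * \<theta> * ((\<Sum>i\<in>UNIV. Xodd lam i u P * So i) + (\<Sum>i\<in>UNIV. Xeven lam i u P * Se i))"
    unfolding gradZ_def Zodd_def Zeven_def m c_def[symmetric] So_def[symmetric] Se_def[symmetric]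
      sum_distrib_left sum_divide_distrib sum.distrib[symmetric] sum_subtractf[symmetric]
    by (intro sum.cong refl) (simp add: algebra_simps add_divide_distrib)
  also have "(\<Sum>i\<in>UNIV. Xodd lam i u P * So i) + (\<Sum>i\<in>UNIV. Xeven lam i u P * Se i)
      = (\<Sum>j\<in>UNIV. \<Sum>k\<in>UNIV. c j k *
        (Xodd lam (ix k) d P * Xeven lam (ix k) u P - Xeven lam (ix k) d P * Xodd lam (ix k) u P))"
    unfolding So_def Se_def sum_select_ix sum.distrib[symmetric]
    by (intro sum.cong refl) (simp add: algebra_simps)
  finally show ?thesis
    unfolding c_def .
qed

text \<open>Euler's identity, by differentiating the homogeneity relation at \<gamma> = 1. The
  relation is given for positive \<gamma> only, so the comparison is made on that open
  half-line.\<close>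

lemma homogeneous_norm_euler:
  fixes d :: "('n::finite, 'h::finite) pt \<Rightarrow> real"
  assumes hom: "homogeneous_norm lam d" and d: "(d has_derivative d') (at P)"
  shows "d' (euler_field P) = d P"
proof -
  have hom': "d (dil \<gamma> P) = \<gamma> * d P" if "0 < \<gamma>" for \<gamma>
    using hom that unfolding homogeneous_norm_def by blast
  have dil: "dil \<gamma> P = (\<gamma> *\<^sub>R fst P, \<gamma>\<^sup>2 *\<^sub>R snd P)" for \<gamma>
    by (simp add: dil_def split_beta scaleR_prod_def)
  have "((\<lambda>\<gamma>. dil \<gamma> P) has_derivative (\<lambda>h. h *\<^sub>R euler_field P)) (at 1)"
    unfolding dil by (auto intro!: derivative_eq_intros simp: euler_field_def algebra_simps)
  then have "((\<lambda>\<gamma>. d (dil \<gamma> P)) has_derivative (\<lambda>h. d' (h *\<^sub>R euler_field P))) (at 1)"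
    by (rule has_derivative_compose) (use d in \<open>simp add: dil\<close>)
  then have "((\<lambda>\<gamma>. \<gamma> * d P) has_derivative (\<lambda>h. d' (h *\<^sub>R euler_field P))) (at 1)"
    by (rule has_derivative_transform_within_open[of _ _ _ _ "{0<..}"])
      (use hom' in auto)
  moreover have "((\<lambda>\<gamma>. \<gamma> * d P) has_derivative (\<lambda>h. h * d P)) (at 1)"
    by (auto intro!: derivative_eq_intros)
  ultimately have "(\<lambda>h. d' (h *\<^sub>R euler_field P)) = (\<lambda>h. h * d P)"
    by (rule has_derivative_unique)
  from fun_cong[OF this, of 1] show ?thesis by simp
qed

lemma Xodd_conv:
  assumes "u differentiable at P"
  shows "Xodd lam i u P = frechet_derivative u (at P) (odd_field lam i P)"
  unfolding Xodd_def ddir_def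
  by (rule linear_odd_field[symmetric]) (rule linear_frechet_derivative[OF assms])

lemma Xeven_conv:
  assumes "u differentiable at P"
  shows "Xeven lam i u P = frechet_derivative u (at P) (even_field lam i P)"
  unfolding Xeven_def ddir_def
  by (rule linear_even_field[symmetric]) (rule linear_frechet_derivative[OF assms])

lemma continuous_on_Xodd:
  assumes "\<And>v. continuous_on S (\<lambda>P. frechet_derivative u (at P) v)"
  shows "continuous_on S (Xodd lam i u)"
  unfolding Xodd_def[abs_def] ddir_def by (intro continuous_intros assms)

lemma continuous_on_Xeven:
  assumes "\<And>v. continuous_on S (\<lambda>P. frechet_derivative u (at P) v)"
  shows "continuous_on S (Xeven lam i u)"
  unfolding Xeven_def[abs_def] ddir_def by (intro continuous_intros assms)

lemma continuous_on_gradZ: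
  assumes u: "\<And>v. continuous_on S (\<lambda>P. frechet_derivative u (at P) v)"
    and d': "\<And>v. continuous_on S (\<lambda>P. frechet_derivative d (at P) v)"
    and d: "continuous_on S d" "\<And>P. P \<in> S \<Longrightarrow> d P \<noteq> 0"
  shows "continuous_on S (gradZ lam ix p \<theta> d u)"
  unfolding gradZ_conv[abs_def]
  by (intro continuous_intros continuous_on_Xodd continuous_on_Xeven u d' d) (use d in auto)

lemma smooth_on_derivative:
  assumes "smooth_on S f" "open S"
  shows "\<And>x. x \<in> S \<Longrightarrow> (f has_derivative frechet_derivative f (at x)) (at x)"
    and "\<And>v. continuous_on S (\<lambda>x. frechet_derivative f (at x) v)"
    and "\<And>x v. x \<in> S \<Longrightarrow> ((\<lambda>z. frechet_derivative f (at z) v) has_derivative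
        frechet_derivative (\<lambda>z. frechet_derivative f (at z) v) (at x)) (at x)"
    and "\<And>v w. continuous_on S (\<lambda>x. frechet_derivative (\<lambda>z. frechet_derivative f (at z) v) (at x) w)"
proof -
  have D: "iter_dd vs f differentiable_on S" and C: "continuous_on S (iter_dd vs f)" for vs
    using assms(1) by (auto simp: smooth_on_def)
  have D': "(iter_dd vs f has_derivative frechet_derivative (iter_dd vs f) (at x)) (at x)" if "x \<in> S" for vs x
    using D[of vs] that assms(2) by (metis differentiable_on_eq_differentiable_at frechet_derivative_works)
  show "(f has_derivative frechet_derivative f (at x)) (at x)" if "x \<in> S" for x
    using D'[OF that, of "[]"] by simp
  show "continuous_on S (\<lambda>x. frechet_derivative f (at x) v)" for v
    using C[of "[v]"] by simp
  show "((\<lambda>z. frechet_derivative f (at z) v) has_derivative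
        frechet_derivative (\<lambda>z. frechet_derivative f (at z) v) (at x)) (at x)" if "x \<in> S" for x v
    using D'[OF that, of "[v]"] by simp
  \<comment> \<open>The head of the list given to \<open>iter_dd\<close> is the direction of the
    last differentiation, hence the order \<open>[w, v]\<close>.\<close>
  show "continuous_on S (\<lambda>x. frechet_derivative (\<lambda>z. frechet_derivative f (at z) v) (at x) w)" for v w
    using C[of "[w, v]"] by simp
qed

text \<open>Smoothness is assumed away from the origin, but the support avoids a neighbourhood of
  it, so \<open>u\<close> is zero there and its derivative is defined and continuous
  everywhere.\<close>

lemma Cc_inf_puncturedD:
  fixes u :: "('n::finite, 'h::finite) pt \<Rightarrow> real"
  assumes "Cc_inf_punctured u"
  defines "K \<equiv> closure {P. u P \<noteq> 0}"
  shows "compact K" "K \<subseteq> - {0}" "\<And>P. P \<notin> K \<Longrightarrow> u P = 0"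
    and "\<And>P. (u has_derivative frechet_derivative u (at P)) (at P)"
    and "\<And>v. continuous_on UNIV (\<lambda>P. frechet_derivative u (at P) v)"
    and "\<And>P v. P \<notin> K \<Longrightarrow> frechet_derivative u (at P) v = 0"
proof -
  show K: "compact K" "K \<subseteq> - {0}"
    using assms(1) by (auto simp: Cc_inf_punctured_def K_def)
  show u0: "u P = 0" if "P \<notin> K" for P
    using that closure_subset[of "{P. u P \<noteq> 0}"] unfolding K_def by blast
  have smooth: "smooth_on (- {0}) u"
    using assms(1) by (simp add: Cc_inf_punctured_def)
  have der0: "(u has_derivative (\<lambda>_. 0)) (at P)" if "P \<notin> K" for P
  proof -
    have "((\<lambda>_. 0) has_derivative (\<lambda>_. 0)) (at P)"
      by simp
    then show ?thesis
      by (rule has_derivative_transform_within_open[of _ _ _ UNIV "- K"])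
        (use that K u0 in \<open>auto intro: compact_imp_closed\<close>)
  qed
  show der: "(u has_derivative frechet_derivative u (at P)) (at P)" for P
  proof (cases "P = 0")
    case True
    then have "P \<notin> K" using K by auto
    then show ?thesis
      using der0 frechet_derivative_works differentiableI by blast
  qed (use smooth_on_derivative(1)[OF smooth, of P] in \<open>simp add: open_Compl\<close>)
  show zero: "frechet_derivative u (at P) v = 0" if "P \<notin> K" for P v
    using has_derivative_unique[OF der der0[OF that]] by simp
  show "continuous_on UNIV (\<lambda>P. frechet_derivative u (at P) v)" for v
    by (rule continuous_on_UNIV_compact_support[OF _ K smooth_on_derivative(2)[OF smooth]])
      (use zero in auto)
qed

text \<open>\<open>f'\<close> is the differential of \<open>d powr (- (p * \<theta>))\<close>. The
  factor \<open>d powr (1 - p * \<theta>)\<close> absorbs both \<open>1 / d\<close> and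
  \<open>1 / d^2\<close>, and the coefficient \<open>- 2 * p * \<theta>\<close> becomes 2 once the
  chain rule factor is put into \<open>f'\<close>.\<close>

lemma gradZ_divergence_form:
  fixes d u :: "('n::finite, 'h::finite) pt \<Rightarrow> real" and p \<theta> :: real
  assumes u: "u differentiable at P" and d: "d differentiable at P" and dpos: "0 < d P"
  defines "f' \<equiv> \<lambda>v. - (p * \<theta>) * d P powr (- (p * \<theta>) - 1) * frechet_derivative d (at P) v"
    and "u' \<equiv> frechet_derivative u (at P)"
  shows "d P powr (1 - p * \<theta>) * gradZ lam ix p \<theta> d u P =
    d P powr (- (p * \<theta>)) * u' (weighted_field ix P)
    + (\<Sum>j\<in>UNIV. \<Sum>k\<in>UNIV. 2 * matrix_inv (Amat lam ix) $ j $ k * snd P $ j *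
        (f' (odd_field lam (ix k) P) * u' (even_field lam (ix k) P)
         - f' (even_field lam (ix k) P) * u' (odd_field lam (ix k) P)))"
proof -
  have lin: "linear u'"
    unfolding u'_def by (rule linear_frechet_derivative[OF u])
  have e1: "d P powr (1 - p * \<theta>) = d P powr (- (p * \<theta>)) * d P"
    using dpos powr_add[of "d P" "- (p * \<theta>)" 1] by (simp add: algebra_simps)
  have e2: "d P powr (1 - p * \<theta>) = d P powr (- (p * \<theta>) - 1) * (d P)\<^sup>2"
    using dpos powr_add[of "d P" "- (p * \<theta>) - 1" 2] by (simp add: algebra_simps powr_numeral)
  have w: "(\<Sum>i\<in>UNIV. (1 + mult_ix ix i) *
       (fst (fst P) $ i * Xodd lam i u P + snd (fst P) $ i * Xeven lam i u P))
    = u' (weighted_field ix P)"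
    unfolding weighted_field_conv_sum[of ix P lam] u'_def[symmetric] Xodd_conv[OF u] Xeven_conv[OF u]
    by (simp only: linear_sum[OF lin] linear_add[OF lin] linear_scale[OF lin] real_scaleR_def)
  have "d P powr (1 - p * \<theta>) * gradZ lam ix p \<theta> d u P
    = d P powr (1 - p * \<theta>) * (u' (weighted_field ix P) / d P)
      + (\<Sum>j\<in>UNIV. \<Sum>k\<in>UNIV. d P powr (1 - p * \<theta>) * (- (2 * p * \<theta>) *
        (matrix_inv (Amat lam ix) $ j $ k * snd P $ j / (d P)\<^sup>2 *
        (Xodd lam (ix k) d P * Xeven lam (ix k) u P - Xeven lam (ix k) d P * Xodd lam (ix k) u P))))"
    unfolding gradZ_conv w sum_distrib_left[symmetric] by (simp add: algebra_simps)
  also have "d P powr (1 - p * \<theta>) * (u' (weighted_field ix P) / d P)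
    = d P powr (- (p * \<theta>)) * u' (weighted_field ix P)"
    using dpos by (simp add: e1)
  also have "(\<Sum>j\<in>UNIV. \<Sum>k\<in>UNIV. d P powr (1 - p * \<theta>) * (- (2 * p * \<theta>) *
        (matrix_inv (Amat lam ix) $ j $ k * snd P $ j / (d P)\<^sup>2 *
        (Xodd lam (ix k) d P * Xeven lam (ix k) u P - Xeven lam (ix k) d P * Xodd lam (ix k) u P))))
    = (\<Sum>j\<in>UNIV. \<Sum>k\<in>UNIV. 2 * matrix_inv (Amat lam ix) $ j $ k * snd P $ j *
        (f' (odd_field lam (ix k) P) * u' (even_field lam (ix k) P)
         - f' (even_field lam (ix k) P) * u' (odd_field lam (ix k) P)))"
  proof (intro sum.cong refl)
    fix j k
    have "r * (d P)\<^sup>2 * (- (2 * p * \<theta>) * (b * t / (d P)\<^sup>2 * (od * ue - de * uo)))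
      = 2 * b * t * (- (p * \<theta>) * r * od * ue - (- (p * \<theta>) * r * de * uo))" for r b t od ue de uo
      using dpos by (simp add: field_simps)
    then show "d P powr (1 - p * \<theta>) * (- (2 * p * \<theta>) *
        (matrix_inv (Amat lam ix) $ j $ k * snd P $ j / (d P)\<^sup>2 *
        (Xodd lam (ix k) d P * Xeven lam (ix k) u P - Xeven lam (ix k) d P * Xodd lam (ix k) u P)))
      = 2 * matrix_inv (Amat lam ix) $ j $ k * snd P $ j *
        (f' (odd_field lam (ix k) P) * u' (even_field lam (ix k) P)
         - f' (even_field lam (ix k) P) * u' (odd_field lam (ix k) P))"
      unfolding e2 f'_def u'_def Xodd_conv[OF u] Xeven_conv[OF u] Xodd_conv[OF d] Xeven_conv[OF d] .
  qed
  finally show ?thesis .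
qed

text \<open>The divergence identity for \<open>\<phi> = \<bar>u\<bar> powr p\<close> and
  \<open>f = d powr a\<close>, \<open>a = - (p * \<theta>)\<close>. By Euler's identity the
  derivative of \<open>f\<close> along \<open>euler_field\<close> is \<open>a f\<close>, which
  lowers Q to Q - p \<theta>.\<close>

lemma integral_gradZ_identity:
  fixes d u :: "('n::finite, 'h::finite) pt \<Rightarrow> real"
  assumes A: "invertible (Amat lam ix)" and hom: "homogeneous_norm lam d"
    and smooth: "smooth_on (- {0}) d" and p: "1 < p" and u: "Cc_inf_punctured u"
  shows "has_bochner_integral lborel
    (\<lambda>P. p * (signed_powr (p - 1) (u P) * d P powr (1 - p * \<theta>) * gradZ lam ix p \<theta> d u P)
      + (real (2 * CARD('n) + 2 * CARD('h)) - p * \<theta>) * (\<bar>u P\<bar> powr p * d P powr (- (p * \<theta>)))) 0"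
proof -
  define K where "K = closure {P. u P \<noteq> 0}"
  note K = Cc_inf_puncturedD(1-3)[OF u, folded K_def] and u' = Cc_inf_puncturedD(4-6)[OF u, folded K_def]
  define a where "a = - (p * \<theta>)"
  have dpos: "0 < d P" if "P \<in> - {0}" for P
    using hom that unfolding homogeneous_norm_def by (metis ComplD singletonI)
  have S: "open (- {0 :: ('n, 'h) pt})" by auto
  note d' = smooth_on_derivative[OF smooth S]
  have dcont: "continuous_on (- {0}) d"
    using hom unfolding homogeneous_norm_def by (meson continuous_on_subset subset_UNIV)
  define B where "B j k = matrix_inv (Amat lam ix) $ j $ k" for j k
  have BA: "(\<Sum>k\<in>UNIV. B j k * lam l (ix k)) = (if j = l then 1 else 0)" for j l
  proof -
    have "(matrix_inv (Amat lam ix) ** Amat lam ix) $ j $ l = (if j = l then 1 else 0)"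
      using matrix_inv_inverse[OF A] by (simp add: mat_def)
    then show ?thesis by (simp add: matrix_matrix_mult_def B_def Amat_def)
  qed
  have AB: "(\<Sum>j\<in>UNIV. lam j (ix k) * B j k) = 1" for k
  proof -
    have "(Amat lam ix ** matrix_inv (Amat lam ix)) $ k $ k = 1"
      using matrix_inv_inverse[OF A] by (simp add: mat_def)
    then show ?thesis by (simp add: matrix_matrix_mult_def B_def Amat_def)
  qed
  define D where "D P = frechet_derivative d (at P)" for P
  define DD where "DD b P = frechet_derivative (\<lambda>z. D z b) (at P)" for b P
  note D = d'(1,2)[folded D_def] and DD = d'(3,4)[folded D_def, folded DD_def]
  define f' where "f' P v = a * d P powr (a - 1) * D P v" for P v
  define H where "H b P v = a * (a - 1) * d P powr (a - 2) * D P v * D P b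
    + a * d P powr (a - 1) * DD b P v" for b P v
  have powr_deriv: "((\<lambda>P. d P powr r) has_derivative (\<lambda>v. r * d P powr (r - 1) * D P v)) (at P)"
    if "P \<in> - {0}" for r P
    using DERIV_compose_FDERIV[OF has_real_derivative_powr[OF dpos[OF that]] D(1)[OF that], of r]
    by (simp add: mult_ac)
  have f: "((\<lambda>P. d P powr a) has_derivative f' P) (at P)" if "P \<in> - {0}" for P
    unfolding f'_def using powr_deriv[OF that] .
  have H: "((\<lambda>P. f' P b) has_derivative H b P) (at P)" if "P \<in> - {0}" for P b
    unfolding f'_def H_def mult.assoc[of a]
    by (rule derivative_eq_intros powr_deriv[OF that] DD(1)[OF that] refl ext)+
      (simp add: algebra_simps)
  have Hcont: "continuous_on (- {0}) (\<lambda>P. H b P v)" for b v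
    unfolding H_def by (intro continuous_intros dcont D(2) DD(2)) (use dpos in force)+
  define U where "U P = frechet_derivative u (at P)" for P
  note U = u'[folded U_def]
  define \<phi>' where "\<phi>' P v = p * signed_powr (p - 1) (u P) * U P v" for P v
  have \<phi>: "((\<lambda>P. \<bar>u P\<bar> powr p) has_derivative \<phi>' P) (at P)" for P
    using DERIV_compose_FDERIV[OF has_real_derivative_abs_powr[OF p] U(1), of P]
    unfolding \<phi>'_def by (simp add: mult_ac)
  have ucont: "continuous_on UNIV u"
    by (intro continuous_at_imp_continuous_on ballI has_derivative_continuous[OF U(1)])
  have \<phi>'cont: "continuous_on UNIV (\<lambda>P. \<phi>' P v)" for v
    unfolding \<phi>'_def using p
    by (intro continuous_intros U(2) continuous_on_compose2[OF continuous_on_signed_powr ucont]) auto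
  have main: "has_bochner_integral lborel (\<lambda>P. d P powr a * \<phi>' P (weighted_field ix P)
      + (\<Sum>j\<in>UNIV. \<Sum>k\<in>UNIV. 2 * B j k * snd P $ j *
          (f' P (odd_field lam (ix k) P) * \<phi>' P (even_field lam (ix k) P)
           - f' P (even_field lam (ix k) P) * \<phi>' P (odd_field lam (ix k) P)))
      + \<bar>u P\<bar> powr p * (real (2 * CARD('n) + 2 * CARD('h)) * d P powr a + f' P (euler_field P))) 0"
    by (rule integral_divergence_identity[OF S K(1,2) _ \<phi> \<phi>'cont f H Hcont BA AB])
      (use K(3) in auto)
  have eq: "d P powr a * \<phi>' P (weighted_field ix P)
      + (\<Sum>j\<in>UNIV. \<Sum>k\<in>UNIV. 2 * B j k * snd P $ j *
          (f' P (odd_field lam (ix k) P) * \<phi>' P (even_field lam (ix k) P)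
           - f' P (even_field lam (ix k) P) * \<phi>' P (odd_field lam (ix k) P)))
      + \<bar>u P\<bar> powr p * (real (2 * CARD('n) + 2 * CARD('h)) * d P powr a + f' P (euler_field P))
    = p * (signed_powr (p - 1) (u P) * d P powr (1 - p * \<theta>) * gradZ lam ix p \<theta> d u P)
      + (real (2 * CARD('n) + 2 * CARD('h)) - p * \<theta>) * (\<bar>u P\<bar> powr p * d P powr (- (p * \<theta>)))"
    (is "?L = ?R") for P
  proof (cases "P = 0")
    \<comment> \<open>At the origin \<open>u\<close> is zero, hence so is every term on both
      sides.\<close>
    case True
    then have "u P = 0" using K by auto
    then show ?thesis by (simp add: \<phi>'_def)
  next
    case False
    define s where "s = p * signed_powr (p - 1) (u P)"
    have Pd: "d differentiable at P" "u differentiable at P"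
      using D(1)[of P] U(1)[of P] False by (auto intro: differentiableI)
    have "0 < d P" using dpos False by auto
    have "D P (euler_field P) = d P"
      using homogeneous_norm_euler[OF hom D(1)] False by simp
    then have euler: "f' P (euler_field P) = a * d P powr a"
      using \<open>0 < d P\<close> powr_add[of "d P" "a - 1" 1] by (simp add: f'_def)
    have "?L = s * (d P powr a * U P (weighted_field ix P)
      + (\<Sum>j\<in>UNIV. \<Sum>k\<in>UNIV. 2 * B j k * snd P $ j *
          (f' P (odd_field lam (ix k) P) * U P (even_field lam (ix k) P)
           - f' P (even_field lam (ix k) P) * U P (odd_field lam (ix k) P))))
      + \<bar>u P\<bar> powr p * (real (2 * CARD('n) + 2 * CARD('h)) * d P powr a + a * d P powr a)"
      unfolding \<phi>'_def euler s_def[symmetric]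
      by (simp add: distrib_left sum_distrib_left mult_ac right_diff_distrib)
    also have "d P powr a * U P (weighted_field ix P)
      + (\<Sum>j\<in>UNIV. \<Sum>k\<in>UNIV. 2 * B j k * snd P $ j *
          (f' P (odd_field lam (ix k) P) * U P (even_field lam (ix k) P)
           - f' P (even_field lam (ix k) P) * U P (odd_field lam (ix k) P)))
      = d P powr (1 - p * \<theta>) * gradZ lam ix p \<theta> d u P"
      unfolding gradZ_divergence_form[OF Pd(2,1) \<open>0 < d P\<close>] B_def U_def f'_def D_def a_def ..
    finally show ?thesis
      by (simp add: s_def a_def algebra_simps)
  qed
  show ?thesis
    using main unfolding eq .
qed

section \<open>The Hardy inequality\<close>

theorem theorem4p4:
  fixes lam :: "'h::finite \<Rightarrow> 'n::finite \<Rightarrow> real"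
    and ix :: "'h \<Rightarrow> 'n"
    and d u :: "('n, 'h) pt \<Rightarrow> real"
    and p \<theta> :: real
  assumes "CARD('h) \<le> CARD('n)"
    and "\<And>j i. lam j i \<ge> 0"
    and "inj (\<lambda>j. \<chi> i. lam j i)"
    and "independent (range (\<lambda>j. \<chi> i. lam j i))"
    and "invertible (Amat lam ix)"
    and "homogeneous_norm lam d"
    and "smooth_on (- {0}) d"
    and "p \<ge> 2"
    and "Cc_inf_punctured u"
  shows "(\<integral>\<^sup>+ P. ennreal (\<bar>gradZ lam ix p \<theta> d u P\<bar> powr p / d P powr (p * (\<theta> - 1))) \<partial>lborel)
         \<ge> ennreal (\<bar>(real (2 * CARD('n) + 2 * CARD('h)) - p * \<theta>) / p\<bar> powr p)
           * (\<integral>\<^sup>+ P. ennreal (\<bar>u P\<bar> powr p / d P powr (p * \<theta>)) \<partial>lborel)"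
proof -
  note A = assms(5) and hom = assms(6) and smooth = assms(7) and u = assms(9)
  have p: "1 < p" using assms(8) by simp
  define K where "K = closure {P. u P \<noteq> 0}"
  note K = Cc_inf_puncturedD(1-3)[OF u, folded K_def] and u' = Cc_inf_puncturedD(4-6)[OF u, folded K_def]
  have dpos: "0 < d P" if "P \<noteq> 0" for P
    using hom that unfolding homogeneous_norm_def by blast
  have S: "open (- {0 :: ('n, 'h) pt})" by auto
  note d' = smooth_on_derivative[OF smooth S]
  have dcont: "continuous_on (- {0}) d"
    using hom unfolding homogeneous_norm_def by (meson continuous_on_subset subset_UNIV)
  have ucont: "continuous_on (- {0}) u"
    by (intro continuous_at_imp_continuous_on ballI has_derivative_continuous[OF u'(1)])
  define \<Gamma> where "\<Gamma> = gradZ lam ix p \<theta> d u"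
  have \<Gamma>cont: "continuous_on (- {0}) \<Gamma>"
    unfolding \<Gamma>_def
    by (intro continuous_on_gradZ continuous_on_subset[OF u'(2)] d'(2) dcont)
      (use dpos in force)+
  have \<Gamma>0: "\<Gamma> P = 0" if "P \<notin> K" for P
    using u'(3)[OF that] by (simp add: \<Gamma>_def gradZ_def Xodd_def Xeven_def ddir_def)
  define c where "c = \<bar>(real (2 * CARD('n) + 2 * CARD('h)) - p * \<theta>) / p\<bar>"
  define h1 where "h1 P = \<bar>u P\<bar> powr p * d P powr (- (p * \<theta>))" for P
  define h2 where "h2 P = \<bar>\<Gamma> P\<bar> powr p * d P powr (- (p * (\<theta> - 1)))" for P
  define M where "M P = signed_powr (p - 1) (u P) * d P powr (1 - p * \<theta>) * \<Gamma> P" for P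
  have dpowr: "continuous_on (- {0}) (\<lambda>P. d P powr r)" for r
    by (intro continuous_intros dcont) (use dpos in force)
  have abspowr: "continuous_on (- {0}) (\<lambda>P. \<bar>g P\<bar> powr p)"
    if "continuous_on (- {0}) g" for g :: "('n, 'h) pt \<Rightarrow> real"
    using that p by (intro continuous_on_powr' continuous_intros) auto
  \<comment> \<open>All three functions vanish off the compact set \<open>K\<close>, and on
    \<open>K\<close> the norm \<open>d\<close> is positive, so its powers are continuous there for
    every exponent.\<close>
  have int: "integrable lborel h1" "integrable lborel h2" "integrable lborel M"
  proof -
    show "integrable lborel h1"
      unfolding h1_def by (rule integrable_compact_support[OF K(1,2)])
        (use K(3) in \<open>auto intro!: continuous_intros dpowr abspowr ucont\<close>)
    show "integrable lborel h2"
      unfolding h2_def by (rule integrable_compact_support[OF K(1,2)])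
        (use \<Gamma>0 in \<open>auto intro!: continuous_intros dpowr abspowr \<Gamma>cont\<close>)
    have "continuous_on (- {0}) (\<lambda>P. signed_powr (p - 1) (u P))"
      using p by (intro continuous_on_compose2[OF continuous_on_signed_powr ucont, of _ UNIV]) auto
    then show "integrable lborel M"
      unfolding M_def by (intro integrable_compact_support[OF K(1,2)])
        (use \<Gamma>0 in \<open>auto intro!: continuous_intros dpowr \<Gamma>cont\<close>)
  qed
  have "has_bochner_integral lborel
      (\<lambda>P. p * M P + (real (2 * CARD('n) + 2 * CARD('h)) - p * \<theta>) * h1 P) 0"
    using integral_gradZ_identity[OF A hom smooth p u] unfolding M_def h1_def \<Gamma>_def .
  then have "p * integral\<^sup>L lborel M
      + (real (2 * CARD('n) + 2 * CARD('h)) - p * \<theta>) * integral\<^sup>L lborel h1 = 0"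
    using int by (simp add: has_bochner_integral_iff)
  then have "integral\<^sup>L lborel M
      = - ((real (2 * CARD('n) + 2 * CARD('h)) - p * \<theta>) / p * integral\<^sup>L lborel h1)"
    using p by (simp add: field_simps)
  then have abs_M: "\<bar>integral\<^sup>L lborel M\<bar> = c * integral\<^sup>L lborel h1"
    by (simp add: c_def abs_mult h1_def)
  have young: "c powr (p - 1) * \<bar>M P\<bar> \<le> (1 - 1 / p) * c powr p * h1 P + h2 P / p" for P
  proof (cases "P = 0")
    case True
    then have "u P = 0" using K by auto
    then show ?thesis using p by (simp add: M_def h1_def h2_def)
  next
    case False
    note [simp] = dpos[OF False]
    \<comment> \<open>Chosen so that \<open>x powr p\<close> and \<open>y powr p\<close> are
      \<open>c powr p * h1 P\<close> and \<open>h2 P\<close>; the exponents of \<open>d\<close> in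
      \<open>x powr (p - 1) * y\<close> add up to
      \<open>- \<theta> * (p - 1) + 1 - \<theta> = 1 - p * \<theta>\<close>, as in
      \<open>M\<close>.\<close>
    define x where "x = c * \<bar>u P\<bar> * d P powr (- \<theta>)"
    define y where "y = \<bar>\<Gamma> P\<bar> * d P powr (1 - \<theta>)"
    have c: "0 \<le> c" by (simp add: c_def)
    have "c powr (p - 1) * \<bar>M P\<bar> = x powr (p - 1) * y"
    proof -
      have "d P powr (1 - p * \<theta>) = d P powr (- \<theta> * (p - 1)) * d P powr (1 - \<theta>)"
        by (simp add: powr_add[symmetric] algebra_simps)
      then show ?thesis
        using c by (simp add: M_def x_def y_def abs_mult powr_mult powr_powr)
    qed
    also have "\<dots> \<le> (1 - 1 / p) * x powr p + y powr p / p"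
      by (rule powr_young) (use p c in \<open>auto simp: x_def y_def\<close>)
    also have "x powr p = c powr p * h1 P"
      using c by (simp add: x_def h1_def powr_mult powr_powr mult_ac)
    also have "y powr p = h2 P"
      by (simp add: y_def h2_def powr_mult powr_powr algebra_simps)
    finally show ?thesis by (simp add: mult.assoc)
  qed
  have "c powr p * integral\<^sup>L lborel h1 = c powr (p - 1) * (c * integral\<^sup>L lborel h1)"
  proof (cases "c = 0")
    case False
    then have "c powr p = c powr (p - 1) * c"
      using powr_add[of c "p - 1" 1] by (simp add: c_def)
    then show ?thesis by simp
  qed simp
  also have "\<dots> \<le> c powr (p - 1) * (\<integral>P. \<bar>M P\<bar> \<partial>lborel)"
    unfolding abs_M[symmetric] by (intro mult_left_mono integral_abs_bound) simp
  also have "\<dots> = (\<integral>P. c powr (p - 1) * \<bar>M P\<bar> \<partial>lborel)"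
    by simp
  also have "\<dots> \<le> (\<integral>P. (1 - 1 / p) * c powr p * h1 P + h2 P / p \<partial>lborel)"
    using int young by (intro integral_mono) auto
  also have "\<dots> = (1 - 1 / p) * c powr p * integral\<^sup>L lborel h1 + integral\<^sup>L lborel h2 / p"
    using int by simp
  \<comment> \<open>Moving the first term to the left leaves the fraction 1/p of it, and
    multiplication by \<open>p\<close> gives the constant 1.\<close>
  finally have "c powr p * integral\<^sup>L lborel h1 \<le> integral\<^sup>L lborel h2"
    using p by (simp add: field_simps)
  then have le: "ennreal (c powr p * integral\<^sup>L lborel h1) \<le> ennreal (integral\<^sup>L lborel h2)"
    by (rule ennreal_leI)
  \<comment> \<open>Both integrands are nonnegative and integrable, so the real inequality carries
    over to the extended integrals of the conclusion.\<close>
  have nn1: "(\<integral>\<^sup>+ P. ennreal (h1 P) \<partial>lborel) = ennreal (integral\<^sup>L lborel h1)"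
    by (rule nn_integral_eq_integral[OF int(1)]) (simp add: h1_def)
  have nn2: "(\<integral>\<^sup>+ P. ennreal (h2 P) \<partial>lborel) = ennreal (integral\<^sup>L lborel h2)"
    by (rule nn_integral_eq_integral[OF int(2)]) (simp add: h2_def)
  have h1: "h1 = (\<lambda>P. \<bar>u P\<bar> powr p / d P powr (p * \<theta>))"
    and h2: "h2 = (\<lambda>P. \<bar>gradZ lam ix p \<theta> d u P\<bar> powr p / d P powr (p * (\<theta> - 1)))"
    by (simp_all add: h1_def h2_def \<Gamma>_def powr_minus divide_inverse fun_eq_iff)
  have "ennreal (c powr p) * (\<integral>\<^sup>+ P. ennreal (h1 P) \<partial>lborel)
      = ennreal (c powr p * integral\<^sup>L lborel h1)"
    unfolding nn1 by (rule ennreal_mult'[symmetric]) simp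
  also have "\<dots> \<le> (\<integral>\<^sup>+ P. ennreal (h2 P) \<partial>lborel)"
    unfolding nn2 by (rule le)
  finally show ?thesis
    unfolding h1 h2 c_def .
qed

end
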